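(* Let $k\ge3$. For $n\ge0$ let $ud(n)$ and $uu(n)$ be the numbers of up-down, respectively up-up, permutations of length $n$ that contain $1\mbox{-}3\mbox{-}2$ exactly once and avoid $2\mbox{-}1\mbox{-}3\mbox{-}\cdots\mbox{-}k$. Writing $U_r$ for $U_r\!\left(\frac1{2x}\right)$, (1) $\displaystyle\sum_{n\ge0}ud(n)x^n=\frac{1}{U_{k-1}^2}\left(\sum_{j=0}^{k-3}U_{j+1}U_j-x\right)$; (2) $\displaystyle\sum_{n\ge0}uu(n)x^n=\frac{1}{xU_{k-1}^2}\left(xU_{k-4}U_{k-2}+\sum_{j=0}^{k-4}U_jU_{j+1}\right)$.
   Context: A permutation of length $n$ is a word $\pi_1\cdots\pi_n$ containing each of $1,\dots,n$ exactly once. A classical pattern $\tau$ of length $m$ (written with dashes) occurs in $\pi$ at indices $i_1<\dots<i_m$ if $\pi_{i_1}\cdots\pi_{i_m}$ is order-isomorphic to $\tau$; containing $\tau$ exactly once means there is exactly one such tuple, avoiding means there is none. $1\mbox{-}3\mbox{-}2$ is the pattern $132$ and $2\mbox{-}1\mbox{-}3\mbox{-}\cdots\mbox{-}k$ is the permutation $2\,1\,3\,4\cdots k$. For $n\ge2$: up-down permutations satisfy $\pi_1<\pi_2>\pi_3<\cdots$ with $n$ odd; up-up ones satisfy $\pi_1<\pi_2>\pi_3<\cdots$ with $n$ even; for $n=0,1$ there are none. $U_r$ is the Chebyshev polynomial of the second kind, $U_r(\cos\theta)=\sin((r+1)\theta)/\sin\theta$; $U_{-1}=0$, $U_0=1$,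 $U_1(t)=2t$, $U_r(t)=2tU_{r-1}(t)-U_{r-2}(t)$. *)

theory Defs
  imports
    Complex_Main
    "HOL-Computational_Algebra.Computational_Algebra"
    "HOL-Combinatorics.Multiset_Permutations"
begin

text \<open>
  Permutations of length \<open>n\<close> are words, i.e. elements of \<open>permutations_of_set {1..n}\<close>.
  List positions start at 0, so the letter usually written \<open>\<pi>\<^sub>i\<close> is \<open>\<pi> ! (i - 1)\<close>.
\<close>

definition order_isomorphic :: "nat list \<Rightarrow> nat list \<Rightarrow> bool" where
  "order_isomorphic u v \<longleftrightarrow> length u = length v \<and>
     (\<forall>a < length u. \<forall>b < length u. u ! a < u ! b \<longleftrightarrow> v ! a < v ! b)"

text \<open>An occurrence is the increasing list of the positions used.\<close>

definition occurrences :: "nat list \<Rightarrow> nat list \<Rightarrow> nat list set" where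
  "occurrences \<tau> \<pi> = {is. sorted_wrt (<) is \<and> set is \<subseteq> {..<length \<pi>} \<and>
                            order_isomorphic (map (\<lambda>i. \<pi> ! i) is) \<tau>}"

definition contains_exactly_once :: "nat list \<Rightarrow> nat list \<Rightarrow> bool" where
  "contains_exactly_once \<pi> \<tau> \<longleftrightarrow> card (occurrences \<tau> \<pi>) = 1"

definition avoids :: "nat list \<Rightarrow> nat list \<Rightarrow> bool" where
  "avoids \<pi> \<tau> \<longleftrightarrow> occurrences \<tau> \<pi> = {}"

definition pattern_132 :: "nat list" where
  "pattern_132 = [1, 3, 2]"

definition pattern_213k :: "nat \<Rightarrow> nat list" where
  "pattern_213k k = [2, 1] @ [3..<Suc k]"

text \<open>\<open>\<pi>\<^sub>1 < \<pi>\<^sub>2 > \<pi>\<^sub>3 < \<dots>\<close>: ascents at the even 0-based positions.\<close>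

definition alternating_up :: "nat list \<Rightarrow> bool" where
  "alternating_up \<pi> \<longleftrightarrow> (\<forall>i. Suc i < length \<pi> \<longrightarrow>
     (if even i then \<pi> ! i < \<pi> ! Suc i else \<pi> ! i > \<pi> ! Suc i))"

definition up_down :: "nat list \<Rightarrow> bool" where
  "up_down \<pi> \<longleftrightarrow> length \<pi> \<ge> 2 \<and> odd (length \<pi>) \<and> alternating_up \<pi>"

definition up_up :: "nat list \<Rightarrow> bool" where
  "up_up \<pi> \<longleftrightarrow> length \<pi> \<ge> 2 \<and> even (length \<pi>) \<and> alternating_up \<pi>"

definition ud :: "nat \<Rightarrow> nat \<Rightarrow> nat" where
  "ud k n = card {\<pi> \<in> permutations_of_set {1..n}. up_down \<pi> \<and>
      contains_exactly_once \<pi> pattern_132 \<and> avoids \<pi> (pattern_213k k)}"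

definition uu :: "nat \<Rightarrow> nat \<Rightarrow> nat" where
  "uu k n = card {\<pi> \<in> permutations_of_set {1..n}. up_up \<pi> \<and>
      contains_exactly_once \<pi> pattern_132 \<and> avoids \<pi> (pattern_213k k)}"

text \<open>
  Chebyshev polynomials of the second kind, with an integer index so that
  \<open>U\<^sub>-\<^sub>1 = 0\<close> is included; the value 0 at indices below \<open>-1\<close> is a dummy.
\<close>

function cheb_U :: "int \<Rightarrow> 'a::comm_ring_1 poly" where
  "cheb_U r = (if r \<le> -1 then 0 else if r = 0 then 1
               else [:0, 2:] * cheb_U (r - 1) - cheb_U (r - 2))"
  by auto
termination by (relation "measure nat") auto

declare cheb_U.simps [simp del]

lemma cheb_U_minus_1: "cheb_U (-1) = 0"
  and cheb_U_0: "cheb_U 0 = 1"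
  and cheb_U_1: "cheb_U 1 = [:0, 2:]"
  and cheb_U_rec: "r \<ge> 1 \<Longrightarrow> cheb_U r = [:0, 2:] * cheb_U (r - 1) - cheb_U (r - 2)"
  by (simp_all add: cheb_U.simps)

lemma cheb_U_cos:
  assumes "r \<ge> -1"
  shows "poly (cheb_U r) (cos \<theta>) * sin \<theta> = sin ((of_int r + 1) * \<theta> :: real)"
  using assms
proof (induction r rule: cheb_U.induct)
  case (1 r)
  consider "r = -1" | "r = 0" | "r \<ge> 1" using "1.prems" by linarith
  then show ?case
  proof cases
    case 3
    then have IH1: "poly (cheb_U (r - 1)) (cos \<theta>) * sin \<theta> = sin (of_int r * \<theta>)"
      and IH2: "poly (cheb_U (r - 2)) (cos \<theta>) * sin \<theta> = sin ((of_int r - 1) * \<theta>)"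
      using 1(1,2) by (auto simp: algebra_simps)
    have "poly (cheb_U r) (cos \<theta>) * sin \<theta> =
        2 * cos \<theta> * (poly (cheb_U (r - 1)) (cos \<theta>) * sin \<theta>) - poly (cheb_U (r - 2)) (cos \<theta>) * sin \<theta>"
      by (simp add: cheb_U_rec[OF 3] algebra_simps)
    also have "\<dots> = sin ((of_int r + 1) * \<theta>)"
      unfolding IH1 IH2 by (simp add: distrib_right left_diff_distrib sin_add sin_diff)
    finally show ?thesis .
  qed (simp_all add: cheb_U_minus_1 cheb_U_0)
qed

text \<open>
  \<open>U\<^sub>r(1/(2x))\<close> is a polynomial in \<open>1/x\<close>; it is read in the field of formal Laurent
  series in \<open>x\<close>, where the generating functions also live.
\<close>

definition Uhat :: "int \<Rightarrow> rat fls" where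
  "Uhat r = poly (cheb_U r) (1 / (2 * fls_X))"

end

theory Submission
  imports Defs "HOL-Library.Sublist"
begin

text \<open>
  Write an alternating permutation as \<open>L n R\<close>, split at its maximum \<open>n\<close>; then \<open>L\<close> has odd length,
  and \<open>L\<close>, \<open>R\<close> are again alternating. If every letter of \<open>L\<close> exceeds every letter of \<open>R\<close>, the
  occurrences of \<open>1-3-2\<close> are those in \<open>L\<close> and those in \<open>R\<close>, and \<open>2-1-3-\<dots>-k\<close> is avoided iff \<open>L\<close>
  avoids \<open>2-1-3-\<dots>-(k-1)\<close> and \<open>R\<close> avoids \<open>2-1-3-\<dots>-k\<close>. Otherwise the single occurrence of \<open>1-3-2\<close>
  is some \<open>l n r\<close>, which forces \<open>L = L' l\<close> with \<open>R - {r} < l < r < L'\<close>.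

  For the generating functions \<open>A\<^sub>k\<close>, \<open>C\<^sub>k\<close> of odd length with no, respectively one, occurrence of
  \<open>1-3-2\<close>, and \<open>D\<^sub>k\<close> of even length with one, this gives \<open>A\<^sub>k = x / (1 - x A\<^sub>k\<^sub>-\<^sub>1) = U\<^sub>k\<^sub>-\<^sub>2 / U\<^sub>k\<^sub>-\<^sub>1\<close>,
  \<open>C\<^sub>k = A\<^sub>k\<^sup>2 (C\<^sub>k\<^sub>-\<^sub>1 + A\<^sub>k\<^sub>-\<^sub>1)\<close> and \<open>D\<^sub>k = C\<^sub>k / x - A\<^sub>k\<^sub>-\<^sub>1 A\<^sub>k\<close>. Hence \<open>U\<^sub>k\<^sub>-\<^sub>1\<^sup>2 C\<^sub>k\<close> telescopes, and
  \<open>D\<^sub>k\<close> follows with the Cassini identity \<open>U\<^sub>r\<^sup>2 - U\<^sub>r\<^sub>-\<^sub>1 U\<^sub>r\<^sub>+\<^sub>1 = 1\<close>.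
\<close>

section \<open>Patterns as subsequences of values\<close>

text \<open>Letters are recorded instead of positions: in a word without repetitions they determine
  the occurrence, and \<open>subseq\<close> splits over \<open>@\<close> without any shift of
  indices.\<close>

definition occ132 :: "nat list \<Rightarrow> (nat \<times> nat \<times> nat) set" where
  "occ132 xs = {(a, b, c). subseq [a, b, c] xs \<and> a < c \<and> c < b}"

text \<open>\<open>has213 j\<close> is containment of \<open>2-1-3-\<dots>-k\<close> for \<open>k = j + 2\<close>, so that \<open>j = 0\<close> is the pattern \<open>2-1\<close>.\<close>

definition has213 :: "nat \<Rightarrow> nat list \<Rightarrow> bool" where
  "has213 j xs \<longleftrightarrow>
     (\<exists>a b w. subseq (a # b # w) xs \<and> b < a \<and> sorted_wrt (<) (a # w) \<and> length w = j)"

lemma set_subseq: "subseq xs ys \<Longrightarrow> set xs \<subseteq> set ys"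
  by (induction rule: list_emb.induct) auto

lemma subseq_mapE:
  assumes "subseq v (map f xs)"
  obtains u where "subseq u xs" "v = map f u"
  using assms by (auto simp: subseq_conv_nths nths_map)

text \<open>Turns the position lists in \<open>occurrences\<close> into subsequences of
  \<open>[0..<n]\<close>, which \<open>(!) \<pi>\<close> maps to subsequences of
  \<open>\<pi>\<close>.\<close>

lemma subseq_upt_iff:
  "subseq is [0..<n] \<longleftrightarrow> sorted_wrt (<) is \<and> set is \<subseteq> {..<n}"
proof
  assume s: "subseq is [0..<n]"
  then obtain N where "is = nths [0..<n] N"
    by (auto simp: subseq_conv_nths)
  then show "sorted_wrt (<) is \<and> set is \<subseteq> {..<n}"
    using set_subseq[OF s]
    by (auto simp: strict_sorted_iff sorted_nths intro: distinct_nthsI)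
next
  assume "sorted_wrt (<) is \<and> set is \<subseteq> {..<n}"
  then show "subseq is [0..<n]"
    by (intro sorted_subset_imp_subseq) (auto simp: strict_sorted_iff)
qed

text \<open>Distinctness gives injectivity. For surjectivity, \<open>\<pi>\<close> is the image of
  \<open>[0..<length \<pi>]\<close> under \<open>(!) \<pi>\<close>, and a subsequence of an image
  lifts.\<close>

lemma bij_betw_occurrences:
  assumes "distinct \<pi>"
  shows "bij_betw (map ((!) \<pi>)) (occurrences \<tau> \<pi>) {v. subseq v \<pi> \<and> order_isomorphic v \<tau>}"
proof (rule bij_betw_imageI)
  have eq: "map ((!) \<pi>) [0..<length \<pi>] = \<pi>"
    by (simp add: map_nth)
  show "inj_on (map ((!) \<pi>)) (occurrences \<tau> \<pi>)"
  proof (rule inj_onI)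
    fix u v
    assume uv: "u \<in> occurrences \<tau> \<pi>" "v \<in> occurrences \<tau> \<pi>" "map ((!) \<pi>) u = map ((!) \<pi>) v"
    have "inj_on ((!) \<pi>) (set u \<union> set v)"
      using uv(1,2) assms by (intro inj_on_nth) (auto simp: occurrences_def)
    then show "u = v"
      using uv(3) by (simp add: inj_on_map_eq_map)
  qed
  show "map ((!) \<pi>) ` occurrences \<tau> \<pi> = {v. subseq v \<pi> \<and> order_isomorphic v \<tau>}"
  proof (intro equalityI subsetI)
    fix v assume "v \<in> map ((!) \<pi>) ` occurrences \<tau> \<pi>"
    then obtain u where u: "v = map ((!) \<pi>) u" "subseq u [0..<length \<pi>]" "order_isomorphic v \<tau>"
      by (auto simp: occurrences_def subseq_upt_iff)
    then show "v \<in> {v. subseq v \<pi> \<and> order_isomorphic v \<tau>}"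
      using subseq_map[OF u(2), of "(!) \<pi>"] by (simp add: eq)
  next
    fix v assume v: "v \<in> {v. subseq v \<pi> \<and> order_isomorphic v \<tau>}"
    then have "subseq v (map ((!) \<pi>) [0..<length \<pi>])"
      by (simp add: eq)
    then obtain u where u: "subseq u [0..<length \<pi>]" "v = map ((!) \<pi>) u"
      by (rule subseq_mapE)
    then have "u \<in> occurrences \<tau> \<pi>"
      using v by (auto simp: occurrences_def subseq_upt_iff)
    then show "v \<in> map ((!) \<pi>) ` occurrences \<tau> \<pi>"
      using u(2) by blast
  qed
qed

lemma order_isomorphic_132_iff:
  "order_isomorphic v pattern_132 \<longleftrightarrow> (\<exists>a b c. v = [a, b, c] \<and> a < c \<and> c < b)"
proof
  assume v: "order_isomorphic v pattern_132"
  then have "length v = 3"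
    by (simp add: order_isomorphic_def pattern_132_def)
  then obtain a b c where abc: "v = [a, b, c]"
    by (auto simp: length_Suc_conv numeral_3_eq_3)
  have *: "v ! i < v ! j \<longleftrightarrow> [1, 3, 2::nat] ! i < [1, 3, 2] ! j" if "i < 3" "j < 3" for i j
    using v that abc by (simp add: order_isomorphic_def pattern_132_def)
  show "\<exists>a b c. v = [a, b, c] \<and> a < c \<and> c < b"
    \<comment> \<open>The first comparison gives \<open>a < c\<close>, the second
      \<open>c < b\<close>.\<close>
    using *[of 0 2] *[of 2 1] abc by auto
next
  assume "\<exists>a b c. v = [a, b, c] \<and> a < c \<and> c < b"
  then show "order_isomorphic v pattern_132"
    by (auto simp: order_isomorphic_def pattern_132_def less_Suc_eq)
qed

lemma contains_exactly_once_132_iff: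
  assumes "distinct \<pi>"
  shows "contains_exactly_once \<pi> pattern_132 \<longleftrightarrow> card (occ132 \<pi>) = 1"
proof -
  have "bij_betw (\<lambda>(a, b, c). [a, b, c]) (occ132 \<pi>)
          {v. subseq v \<pi> \<and> order_isomorphic v pattern_132}"
    by (rule bij_betwI[where g = "\<lambda>v. (v ! 0, v ! 1, v ! 2)"])
       (auto simp: occ132_def order_isomorphic_132_iff)
  then have "card (occ132 \<pi>) = card {v. subseq v \<pi> \<and> order_isomorphic v pattern_132}"
    by (rule bij_betw_same_card)
  also have "\<dots> = card (occurrences pattern_132 \<pi>)"
    using bij_betw_occurrences[OF assms] by (rule bij_betw_same_card[symmetric])
  finally show ?thesis
    by (simp add: contains_exactly_once_def)
qed

lemma order_isomorphic_213k_iff: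
  "order_isomorphic v (pattern_213k (Suc (Suc j))) \<longleftrightarrow>
     (\<exists>a b w. v = a # b # w \<and> b < a \<and> sorted_wrt (<) (a # w) \<and> length w = j)"
proof -
  let ?p = "pattern_213k (Suc (Suc j))"
  have len: "length ?p = Suc (Suc j)"
    by (simp add: pattern_213k_def del: upt_Suc)
  have p: "?p ! 0 = 2" "?p ! 1 = 1" "\<And>i. i < j \<Longrightarrow> ?p ! Suc (Suc i) = i + 3"
    by (auto simp: pattern_213k_def nth_append simp del: upt_Suc)
  show ?thesis
  proof
    assume iso: "order_isomorphic v ?p"
    then have lv: "length v = Suc (Suc j)"
      by (simp add: order_isomorphic_def len)
    then obtain a b w where v: "v = a # b # w" "length w = j"
      by (auto simp: length_Suc_conv)
    have *: "v ! i < v ! l \<longleftrightarrow> ?p ! i < ?p ! l" if "i < Suc (Suc j)" "l < Suc (Suc j)" for i l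
      using iso that by (simp add: order_isomorphic_def lv)
    have "b < a"
      using *[of 1 0] p by (simp add: v)
    moreover have "a < w ! i" if "i < j" for i
      using *[of 0 "Suc (Suc i)"] p that by (simp add: v)
    moreover have "w ! i < w ! l" if "i < l" "l < j" for i l
      using *[of "Suc (Suc i)" "Suc (Suc l)"] p that by (simp add: v)
    ultimately have "b < a" "\<forall>x\<in>set w. a < x" "sorted_wrt (<) w"
      using v(2) by (auto simp: sorted_wrt_iff_nth_less in_set_conv_nth)
    then show "\<exists>a b w. v = a # b # w \<and> b < a \<and> sorted_wrt (<) (a # w) \<and> length w = j"
      using v by auto
  next
    assume "\<exists>a b w. v = a # b # w \<and> b < a \<and> sorted_wrt (<) (a # w) \<and> length w = j"
    then obtain a b w where v: "v = a # b # w" "b < a" "sorted_wrt (<) (a # w)" "length w = j"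
      by blast
    have aw: "a < w ! i" "b < w ! i" if "i < j" for i
      using v that less_trans[of b a "w ! i"] by auto
    have ww: "w ! i < w ! l \<longleftrightarrow> i < l" if "i < j" "l < j" for i l
      using v that
      by (metis sorted_wrt_iff_nth_less sorted_wrt.simps(2) linorder_neqE_nat less_asym less_irrefl)
    have "v ! i < v ! l \<longleftrightarrow> ?p ! i < ?p ! l" if "i < Suc (Suc j)" "l < Suc (Suc j)" for i l
    proof -
      \<comment> \<open>Each position is 0, 1 or in the increasing tail, which leaves nine
        comparisons.\<close>
      have *: "x = 0 \<or> x = 1 \<or> (\<exists>x'<j. x = Suc (Suc x'))" if "x < Suc (Suc j)" for x
        using that by (cases x rule: nat.exhaust; cases "x - 1") auto
      have "\<not> a < b" "\<not> w ! m < a" "\<not> w ! m < b" if "m < j" for m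
        using v(2) aw[OF that] by (simp_all add: less_not_sym)
      then show ?thesis
        using *[OF that(1)] *[OF that(2)]
        by (elim disjE exE conjE) (simp_all add: v(1,2) p p(2)[simplified] aw ww less_not_sym)
    qed
    then show "order_isomorphic v ?p"
      using v(1,4) len by (simp add: order_isomorphic_def)
  qed
qed

lemma avoids_213k_iff:
  assumes "distinct \<pi>"
  shows "avoids \<pi> (pattern_213k (Suc (Suc j))) \<longleftrightarrow> \<not> has213 j \<pi>"
proof -
  have "occurrences (pattern_213k (Suc (Suc j))) \<pi> = {} \<longleftrightarrow>
      {v. subseq v \<pi> \<and> order_isomorphic v (pattern_213k (Suc (Suc j)))} = {}"
    using bij_betw_occurrences[OF assms, of "pattern_213k (Suc (Suc j))"]
    by (auto simp: bij_betw_def)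
  then show ?thesis
    unfolding avoids_def has213_def order_isomorphic_213k_iff by blast
qed

section \<open>Properties invariant under order isomorphism\<close>

text \<open>The words on both sides of the maximum use letter sets other than \<open>{1..m}\<close>.
  Monotonicity is asked only on the letters of the word, so that any increasing relabelling of a
  finite letter set qualifies.\<close>

definition order_invariant :: "(nat list \<Rightarrow> bool) \<Rightarrow> bool" where
  "order_invariant Q \<longleftrightarrow> (\<forall>f xs. strict_mono_on (set xs) f \<longrightarrow> Q (map f xs) = Q xs)"

definition num_perms :: "(nat list \<Rightarrow> bool) \<Rightarrow> nat \<Rightarrow> nat" where
  "num_perms Q n = card {xs \<in> permutations_of_set {1..n}. Q xs}"

lemma strict_mono_on_less_iff:
  fixes f :: "nat \<Rightarrow> nat"
  assumes "strict_mono_on S f" "x \<in> S" "y \<in> S"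
  shows "f x < f y \<longleftrightarrow> x < y"
  using assms by (metis linorder_neqE_nat order_less_asym strict_mono_onD)

lemma order_invariant_conj:
  "order_invariant P \<Longrightarrow> order_invariant Q \<Longrightarrow> order_invariant (\<lambda>xs. P xs \<and> Q xs)"
  by (simp add: order_invariant_def)

lemma order_invariant_not: "order_invariant P \<Longrightarrow> order_invariant (\<lambda>xs. \<not> P xs)"
  by (simp add: order_invariant_def)

lemma order_invariant_length: "order_invariant (\<lambda>xs. P (length xs))"
  by (simp add: order_invariant_def)

lemma order_invariant_alternating_up: "order_invariant alternating_up"
  unfolding order_invariant_def
proof (intro allI impI)
  fix f :: "nat \<Rightarrow> nat" and xs assume f: "strict_mono_on (set xs) f"
  have "f (xs ! i) < f (xs ! j) \<longleftrightarrow> xs ! i < xs ! j" if "i < length xs" "j < length xs" for i j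
    using that by (intro strict_mono_on_less_iff[OF f]) simp_all
  then show "alternating_up (map f xs) = alternating_up xs"
    unfolding alternating_up_def by (auto simp: Suc_lessD)
qed

lemma occ132_map:
  assumes "strict_mono_on (set xs) f"
  shows "occ132 (map f xs) = map_prod f (map_prod f f) ` occ132 xs"
proof (intro equalityI subsetI)
  fix t assume "t \<in> occ132 (map f xs)"
  then obtain a b c where t: "t = (a, b, c)" "subseq [a, b, c] (map f xs)" "a < c" "c < b"
    by (auto simp: occ132_def)
  from t(2) obtain u where u: "subseq u xs" "[a, b, c] = map f u"
    by (rule subseq_mapE)
  then obtain a' b' c' where u': "u = [a', b', c']" "a = f a'" "b = f b'" "c = f c'"
    by (auto simp: Cons_eq_map_conv)
  with u set_subseq[OF u(1)] t assms have "(a', b', c') \<in> occ132 xs"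
    by (simp add: occ132_def strict_mono_on_less_iff)
  then show "t \<in> map_prod f (map_prod f f) ` occ132 xs"
    using t u' by force
next
  fix t assume "t \<in> map_prod f (map_prod f f) ` occ132 xs"
  then obtain a b c where t: "t = (f a, f b, f c)" "subseq [a, b, c] xs" "a < c" "c < b"
    by (auto simp: occ132_def)
  then show "t \<in> occ132 (map f xs)"
    using subseq_map[OF t(2), of f] set_subseq[OF t(2)]
    by (simp add: occ132_def strict_mono_on_less_iff[OF assms])
qed

lemma occ132_subset: "occ132 xs \<subseteq> set xs \<times> set xs \<times> set xs"
  by (auto simp: occ132_def dest: set_subseq)

lemma finite_occ132: "finite (occ132 xs)"
  using occ132_subset by (rule finite_subset) simp

lemma order_invariant_card_occ132: "order_invariant (\<lambda>xs. P (card (occ132 xs)))"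
  unfolding order_invariant_def
proof (intro allI impI)
  fix f :: "nat \<Rightarrow> nat" and xs assume f: "strict_mono_on (set xs) f"
  then have "inj_on f (set xs)"
    by (rule strict_mono_on_imp_inj_on)
  then have "inj_on (map_prod f (map_prod f f)) (set xs \<times> set xs \<times> set xs)"
    by (intro map_prod_inj_on)
  then have "card (occ132 (map f xs)) = card (occ132 xs)"
    unfolding occ132_map[OF f] using occ132_subset by (intro card_image) (rule inj_on_subset)
  then show "P (card (occ132 (map f xs))) = P (card (occ132 xs))"
    by simp
qed

lemma order_invariant_has213: "order_invariant (has213 j)"
  unfolding order_invariant_def
proof (intro allI impI)
  fix f :: "nat \<Rightarrow> nat" and xs assume f: "strict_mono_on (set xs) f"
  have *: "f b < f a \<and> sorted_wrt (<) (f a # map f w) \<longleftrightarrow> b < a \<and> sorted_wrt (<) (a # w)"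
    if "subseq (a # b # w) xs" for a b w
  proof -
    have sub: "a \<in> set xs" "b \<in> set xs" "set w \<subseteq> set xs"
      using set_subseq[OF that] by auto
    then have "sorted_wrt (<) (map f w) \<longleftrightarrow> sorted_wrt (<) w"
      by (auto simp: sorted_wrt_iff_nth_less strict_mono_on_less_iff[OF f] subset_iff)
    moreover have "(\<forall>x\<in>set w. f a < f x) \<longleftrightarrow> (\<forall>x\<in>set w. a < x)" "f b < f a \<longleftrightarrow> b < a"
      using sub by (auto simp: strict_mono_on_less_iff[OF f] subset_iff)
    ultimately show ?thesis
      by simp
  qed
  show "has213 j (map f xs) = has213 j xs"
  proof
    assume "has213 j (map f xs)"
    then obtain a b w where abw: "subseq (a # b # w) (map f xs)"
        "b < a \<and> sorted_wrt (<) (a # w)" "length w = j"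
      by (auto simp: has213_def)
    from abw(1) obtain u where u: "subseq u xs" "a # b # w = map f u"
      by (rule subseq_mapE)
    then obtain a' b' w' where u': "u = a' # b' # w'" "a = f a'" "b = f b'" "w = map f w'"
      by (auto simp: Cons_eq_map_conv)
    show "has213 j xs"
      using abw u u' * unfolding has213_def by (metis length_map)
  next
    assume "has213 j xs"
    then obtain a b w where abw: "subseq (a # b # w) xs"
        "b < a \<and> sorted_wrt (<) (a # w)" "length w = j"
      by (auto simp: has213_def)
    then show "has213 j (map f xs)"
      using subseq_map[OF abw(1), of f] *[OF abw(1)] unfolding has213_def
      by (metis length_map list.simps(9))
  qed
qed

lemma card_permutations_order_invariant:
  fixes S :: "nat set"
  assumes "order_invariant Q" "finite S"
  shows "card {xs \<in> permutations_of_set S. Q xs} = num_perms Q (card S)"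
proof -
  \<comment> \<open>The increasing enumeration of \<open>S\<close>, shifted by one because letters
    start at 1 and list positions at 0.\<close>
  define f where "f = (\<lambda>i. sorted_list_of_set S ! (i - 1))"
  let ?s = "sorted_list_of_set S"
  have mono: "strict_mono_on {1..card S} f"
    unfolding f_def using assms(2)
    by (intro strict_mono_onI)
       (auto intro!: sorted_wrt_nth_less[OF strict_sorted_list_of_set])
  have img: "f ` {1..card S} = S"
  proof -
    have "f ` {1..card S} = (!) ?s ` {..<card S}"
    proof -
      have "{..<card S} = (\<lambda>i. i - 1) ` {1..card S}"
        by (force simp: image_iff)
      then show ?thesis
        by (simp add: f_def image_image)
    qed
    also have "\<dots> = set ?s"
      by (auto simp: set_conv_nth)
    finally show ?thesis
      using assms(2) by simp
  qed
  have inj: "inj_on f {1..card S}"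
    using mono by (rule strict_mono_on_imp_inj_on)
  have "{xs \<in> permutations_of_set S. Q xs} = map f ` {xs \<in> permutations_of_set {1..card S}. Q xs}"
  proof -
    have "permutations_of_set S = map f ` permutations_of_set {1..card S}"
      using permutations_of_set_image_inj[OF inj] img by simp
    moreover have "Q (map f xs) = Q xs" if "xs \<in> permutations_of_set {1..card S}" for xs
      using assms(1) mono permutations_of_setD(1)[OF that] by (simp add: order_invariant_def)
    ultimately show ?thesis
      by auto
  qed
  moreover have "inj_on (map f) {xs \<in> permutations_of_set {1..card S}. Q xs}"
  proof (rule inj_onI)
    fix u v
    assume "u \<in> {xs \<in> permutations_of_set {1..card S}. Q xs}"
      "v \<in> {xs \<in> permutations_of_set {1..card S}. Q xs}" "map f u = map f v"
    then show "u = v"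
      using inj by (auto simp: permutations_of_set_def dest!: inj_on_map_eq_map[THEN iffD1, rotated])
  qed
  ultimately show ?thesis
    by (simp add: num_perms_def card_image)
qed

text \<open>\<open>mid i\<close> holds the letters between \<open>L\<close> and \<open>n\<close> that are forced by the length \<open>i\<close> of \<open>L\<close>.\<close>

lemma card_split_at_max:
  fixes A B :: "nat \<Rightarrow> nat set" and mid :: "nat \<Rightarrow> nat list"
  assumes "order_invariant P" "order_invariant Q" "finite I"
    and A: "\<And>i. i \<in> I \<Longrightarrow> finite (A i) \<and> card (A i) = i \<and> n \<notin> A i"
    and B: "\<And>i. i \<in> I \<Longrightarrow> finite (B i) \<and> n \<notin> B i"
    and mid: "\<And>i. i \<in> I \<Longrightarrow> length (mid i) = c \<and> n \<notin> set (mid i)"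
  shows "card {(L @ mid i) @ n # R | i L R. i \<in> I \<and> L \<in> permutations_of_set (A i) \<and> P L \<and>
                  R \<in> permutations_of_set (B i) \<and> Q R} =
         (\<Sum>i\<in>I. num_perms P i * num_perms Q (card (B i)))"
proof -
  define X where "X i = {L \<in> permutations_of_set (A i). P L}" for i
  define Y where "Y i = {R \<in> permutations_of_set (B i). Q R}" for i
  define g where "g i = (\<lambda>(L, R). (L @ mid i) @ n # R)" for i
  have fin: "finite (X i)" "finite (Y i)" for i
    by (simp_all add: X_def Y_def)
  have XD: "length L = i" "n \<notin> set (L @ mid i)" if "i \<in> I" "L \<in> X i" for i L
    using that A mid length_finite_permutations_of_set[of L "A i"]
    by (auto simp: X_def permutations_of_set_def)
  have YD: "n \<notin> set R" if "i \<in> I" "R \<in> Y i" for i R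
    using that B by (auto simp: Y_def permutations_of_set_def)
  \<comment> \<open>The letter \<open>n\<close> occurs once, so the word determines what stands on
    either side of it. All \<open>mid i\<close> have the same length \<open>c\<close>, so the
    position of \<open>n\<close> recovers \<open>i\<close>.\<close>
  have g_eq: "i = i' \<and> L = L' \<and> R = R'"
    if "g i (L, R) = g i' (L', R')" "i \<in> I" "i' \<in> I" "L \<in> X i" "L' \<in> X i'" "R \<in> Y i" "R' \<in> Y i'"
    for i i' L L' R R'
  proof -
    have "L @ mid i = L' @ mid i' \<and> R = R'"
      using that append_Cons_eq_iff[OF XD(2) YD, of i L i R "L' @ mid i'" R']
      by (simp add: g_def del: append_assoc)
    moreover from this have "length L + c = length L' + c"
      using mid that by (metis length_append)
    ultimately show ?thesis
      using XD(1) that by auto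
  qed
  have "{(L @ mid i) @ n # R | i L R. i \<in> I \<and> L \<in> permutations_of_set (A i) \<and> P L \<and>
           R \<in> permutations_of_set (B i) \<and> Q R} = (\<Union>i\<in>I. g i ` (X i \<times> Y i))"
    by (force simp: g_def X_def Y_def)
  also have "card \<dots> = (\<Sum>i\<in>I. card (g i ` (X i \<times> Y i)))"
  proof (rule card_UN_disjoint)
    show "\<forall>i\<in>I. \<forall>i'\<in>I. i \<noteq> i' \<longrightarrow> g i ` (X i \<times> Y i) \<inter> g i' ` (X i' \<times> Y i') = {}"
    proof (intro ballI impI equals0I)
      fix i i' w assume "i \<in> I" "i' \<in> I" "i \<noteq> i'" "w \<in> g i ` (X i \<times> Y i) \<inter> g i' ` (X i' \<times> Y i')"
      then show False
        by (elim IntE imageE SigmaE) (metis g_eq)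
    qed
  qed (use assms(3) fin in auto)
  also have "\<dots> = (\<Sum>i\<in>I. card (X i \<times> Y i))"
  proof (intro sum.cong refl card_image inj_onI)
    fix i s t assume "i \<in> I" "s \<in> X i \<times> Y i" "t \<in> X i \<times> Y i" "g i s = g i t"
    then show "s = t"
      by (elim SigmaE) (metis g_eq)
  qed
  also have "\<dots> = (\<Sum>i\<in>I. num_perms P i * num_perms Q (card (B i)))"
  proof (rule sum.cong)
    fix i assume i: "i \<in> I"
    have "card (X i) = num_perms P i"
      using card_permutations_order_invariant[OF assms(1), of "A i"] A[OF i] by (simp add: X_def)
    moreover have "card (Y i) = num_perms Q (card (B i))"
      using card_permutations_order_invariant[OF assms(2), of "B i"] B[OF i] by (simp add: Y_def)
    ultimately show "card (X i \<times> Y i) = num_perms P i * num_perms Q (card (B i))"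
      by (simp add: card_cartesian_product)
  qed simp
  finally show ?thesis .
qed

section \<open>Splitting at the maximum\<close>

text \<open>An even prefix preserves the parity of positions, so \<open>ys\<close> again starts with
  an ascent, and the step from \<open>xs\<close> to \<open>ys\<close> starts at an odd position and
  must be a descent.\<close>

lemma alternating_up_append:
  assumes "even (length xs)"
  shows "alternating_up (xs @ ys) \<longleftrightarrow>
    alternating_up xs \<and> alternating_up ys \<and> (xs \<noteq> [] \<longrightarrow> ys \<noteq> [] \<longrightarrow> hd ys < last xs)"
    (is "?l \<longleftrightarrow> ?r")
proof
  assume l: ?l
  have s: "if even i then (xs @ ys) ! i < (xs @ ys) ! Suc i else (xs @ ys) ! i > (xs @ ys) ! Suc i"
    if "Suc i < length xs + length ys" for i
    using l that by (simp add: alternating_up_def)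
  have "alternating_up xs"
    unfolding alternating_up_def
  proof (intro allI impI)
    fix i assume "Suc i < length xs"
    then show "if even i then xs ! i < xs ! Suc i else xs ! i > xs ! Suc i"
      using s[of i] by (simp add: nth_append split: if_splits)
  qed
  moreover have "alternating_up ys"
    unfolding alternating_up_def
  proof (intro allI impI)
    fix i assume "Suc i < length ys"
    then show "if even i then ys ! i < ys ! Suc i else ys ! i > ys ! Suc i"
      using s[of "length xs + i"] assms by (simp add: nth_append split: if_splits)
  qed
  moreover have "hd ys < last xs" if "xs \<noteq> []" "ys \<noteq> []"
  proof -
    from that have "length xs > 0" "length ys > 0"
      by auto
    then show ?thesis
      using s[of "length xs - 1"] assms that
      by (auto simp: nth_append last_conv_nth hd_conv_nth)
  qed
  ultimately show ?r
    by blast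
next
  assume r: ?r
  show ?l
    unfolding alternating_up_def
  proof (intro allI impI)
    fix i assume i: "Suc i < length (xs @ ys)"
    consider "Suc i < length xs" | "Suc i = length xs" | i' where "i = length xs + i'"
      by (metis Suc_lessI le_iff_add not_less)
    then show "if even i then (xs @ ys) ! i < (xs @ ys) ! Suc i else (xs @ ys) ! i > (xs @ ys) ! Suc i"
    proof cases
      case 1
      then show ?thesis
        using r by (auto simp: nth_append alternating_up_def)
    next
      case 2
      then have "odd i"
        using assms by (metis even_Suc)
      moreover have "xs \<noteq> []" "ys \<noteq> []" "i = length xs - 1"
        using i 2 by auto
      ultimately show ?thesis
        using r 2 by (auto simp: nth_append last_conv_nth hd_conv_nth)
    next
      case 3
      then show ?thesis
        using r i assms by (auto simp: nth_append alternating_up_def)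
    qed
  qed
qed

lemma alternating_up_Nil: "alternating_up []"
  and alternating_up_single: "alternating_up [x]"
  by (simp_all add: alternating_up_def)

lemma alternating_up_snoc_above:
  assumes "\<And>x. x \<in> set L \<Longrightarrow> x < M" "odd (length L)"
  shows "alternating_up (L @ [M]) \<longleftrightarrow> alternating_up L"
proof
  assume r: "alternating_up (L @ [M])"
  show "alternating_up L"
    unfolding alternating_up_def
  proof (intro allI impI)
    fix i assume "Suc i < length L"
    then show "if even i then L ! i < L ! Suc i else L ! i > L ! Suc i"
      using r[unfolded alternating_up_def, rule_format, of i]
      by (simp add: nth_append split: if_splits)
  qed
next
  assume r: "alternating_up L"
  show "alternating_up (L @ [M])"
    unfolding alternating_up_def
  proof (intro allI impI)
    fix i assume i: "Suc i < length (L @ [M])"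
    show "if even i then (L @ [M]) ! i < (L @ [M]) ! Suc i else (L @ [M]) ! i > (L @ [M]) ! Suc i"
    proof (cases "Suc i = length L")
      case True
      then have "even i" "i < length L"
        using assms(2) by (metis even_Suc, simp)
      then show ?thesis
        using True assms(1) by (simp add: nth_append)
    next
      case False
      then show ?thesis
        using r i by (simp add: nth_append alternating_up_def)
    qed
  qed
qed

lemma alternating_up_snoc_below:
  assumes "\<And>x. x \<in> set L \<Longrightarrow> m < x" "even (length L)"
  shows "alternating_up (L @ [m]) \<longleftrightarrow> alternating_up L"
  using assms by (auto simp: alternating_up_append alternating_up_single)

text \<open>The maximum must be a peak, so its 0-based position, the length of \<open>L\<close>, is
  odd. The word \<open>[M]\<close> is excluded because it alternates although its \<open>L\<close>
  has even length.\<close>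

lemma alternating_up_split_max:
  assumes max: "\<And>x. x \<in> set L \<union> set R \<Longrightarrow> x < M" and "L \<noteq> [] \<or> R \<noteq> []"
  shows "alternating_up (L @ M # R) \<longleftrightarrow> odd (length L) \<and> alternating_up L \<and> alternating_up R"
proof (cases "even (length L)")
  case True
  have "\<not> alternating_up (L @ M # R)"
  proof
    assume a: "alternating_up (L @ M # R)"
    show False
    proof (cases "L = []")
      case True
      then obtain y ys where "R = y # ys"
        using assms(2) by (cases R) auto
      then show False
        using a[unfolded alternating_up_def, rule_format, of 0] max[of y] True by simp
    next
      case False
      then show False
        using a max[of "last L"] True by (simp add: alternating_up_append)
    qed
  qed
  then show ?thesis
    using True by simp
next
  case False
  have "alternating_up ((L @ [M]) @ R) \<longleftrightarrow> alternating_up (L @ [M]) \<and> alternating_up R"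
    using False max by (subst alternating_up_append) (auto simp: hd_in_set)
  then show ?thesis
    using alternating_up_snoc_above[of L M] False max by simp
qed

section \<open>Occurrences of 1-3-2 around the maximum\<close>

lemma subseq3_append_iff:
  "subseq [a, b, c] (xs @ ys) \<longleftrightarrow>
     subseq [a, b, c] xs \<or> subseq [a, b] xs \<and> c \<in> set ys \<or>
     a \<in> set xs \<and> subseq [b, c] ys \<or> subseq [a, b, c] ys"
proof -
  have "subseq [a, b, c] (xs @ ys)" if "subseq [a, b] xs" "c \<in> set ys"
    using list_emb_append_mono[OF that(1), of "[c]" ys] that(2) by (simp add: subseq_singleton_left)
  moreover have "subseq [a, b, c] (xs @ ys)" if "a \<in> set xs" "subseq [b, c] ys"
    using list_emb_append_mono[OF _ that(2), of "[a]" xs] that(1) by (simp add: subseq_singleton_left)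
  moreover have "subseq [a, b, c] (xs @ ys)" if "subseq [a, b, c] xs \<or> subseq [a, b, c] ys"
    using that by (auto intro: subseq_rev_drop_many subseq_drop_many)
  moreover have "subseq [a, b, c] xs \<or> subseq [a, b] xs \<and> c \<in> set ys \<or>
     a \<in> set xs \<and> subseq [b, c] ys \<or> subseq [a, b, c] ys" if "subseq [a, b, c] (xs @ ys)"
    using that by (auto simp: subseq_append_iff Cons_eq_append_conv subseq_singleton_left)
  ultimately show ?thesis
    by blast
qed

text \<open>An occurrence that meets both sides has its 1 in \<open>L\<close> and its 2 in
  \<open>R\<close>, which contradicts \<open>sep\<close>. One that uses \<open>M\<close> must use it
  as the 3, with the same consequence.\<close>

lemma occ132_split_max:
  assumes max: "\<And>x. x \<in> set L \<union> set R \<Longrightarrow> x < M"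
    and sep: "\<And>l r. l \<in> set L \<Longrightarrow> r \<in> set R \<Longrightarrow> r < l"
  shows "occ132 (L @ M # R) = occ132 L \<union> occ132 R"
proof (intro equalityI subsetI)
  fix t assume "t \<in> occ132 (L @ M # R)"
  then obtain a b c where t: "t = (a, b, c)" "subseq [a, b, c] (L @ M # R)" "a < c" "c < b"
    by (auto simp: occ132_def)
  have memL: "x \<in> set L" if "subseq [a, b] L" "x = a \<or> x = b" for x
    using set_subseq[OF that(1)] that(2) by auto
  have "subseq [a, b, c] L \<or> subseq [a, b, c] R"
    using t(2) unfolding subseq3_append_iff
  proof (elim disjE conjE)
    assume "subseq [a, b] L" "c \<in> set (M # R)"
    then show ?thesis
      using max[of b] sep[of a c] t(3,4) memL by auto
  next
    assume a: "a \<in> set L" "subseq [b, c] (M # R)"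
    then have "c \<in> set R"
      by (auto simp: subseq_singleton_left split: if_splits dest: set_subseq)
    then show ?thesis
      using sep[of a c] a t(3) by auto
  next
    assume "subseq [a, b, c] (M # R)"
    moreover have "a \<noteq> M"
      using max[of c] calculation t(3) by (auto split: if_splits dest: set_subseq)
    ultimately show ?thesis
      by simp
  qed blast
  then show "t \<in> occ132 L \<union> occ132 R"
    using t by (auto simp: occ132_def)
next
  fix t assume "t \<in> occ132 L \<union> occ132 R"
  then show "t \<in> occ132 (L @ M # R)"
    by (auto simp: occ132_def intro: subseq_rev_drop_many subseq_drop_many)
qed

lemma occ132_split_max_nonempty:
  assumes "l \<in> set L" "r \<in> set R" "l < r" "r < M"
  shows "(l, M, r) \<in> occ132 (L @ M # R)"
  using assms unfolding occ132_def subseq3_append_iff by (simp add: subseq_singleton_left)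

text \<open>All of \<open>l # R\<close> lies below \<open>L\<close>, so an occurrence starting in
  \<open>L\<close> stays in \<open>L\<close>. One starting at \<open>l\<close> must end in
  \<open>r\<close>, the only letter of \<open>R\<close> above \<open>l\<close>, and then its 3 can
  only be \<open>M\<close>.\<close>

lemma occ132_crossing:
  assumes max: "\<And>x. x \<in> set L \<union> set R \<Longrightarrow> x < M" and lM: "l < M"
    and L: "\<And>x. x \<in> set L \<Longrightarrow> r < x" and lr: "l < r" "r \<in> set R"
    and R: "\<And>y. y \<in> set R \<Longrightarrow> y \<noteq> r \<Longrightarrow> y < l"
    and occ: "occ132 L = {}" "occ132 R = {}"
  shows "occ132 (L @ l # M # R) = {(l, M, r)}"
proof (intro equalityI subsetI)
  fix t assume "t \<in> occ132 (L @ l # M # R)"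
  then obtain a b c where t: "t = (a, b, c)" "subseq [a, b, c] (L @ l # M # R)" "a < c" "c < b"
    by (auto simp: occ132_def)
  have small: "z < x" if "x \<in> set L" "z \<in> set (l # R)" for x z
  proof -
    have "z \<le> r"
      using that(2) R[of z] lr(1) by (cases "z = r") auto
    then show ?thesis
      using L[OF that(1)] by simp
  qed
  from t(2) have "subseq [a, b, c] (l # M # R)"
    unfolding subseq3_append_iff
  proof (elim disjE conjE)
    assume "subseq [a, b, c] L"
    then have "(a, b, c) \<in> occ132 L"
      using t(3,4) by (simp add: occ132_def)
    then show ?thesis
      by (simp add: occ(1))
  next
    assume *: "subseq [a, b] L" "c \<in> set (l # M # R)"
    then have "a \<in> set L" "b \<in> set L"
      using set_subseq[OF *(1)] by auto
    then show ?thesis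
      using small[of a c] max[of b] * t(3,4) by auto
  next
    assume *: "a \<in> set L" "subseq [b, c] (l # M # R)"
    then have "b \<in> set (l # M # R)" "c \<in> set (l # M # R)"
      using set_subseq[OF *(2)] by auto
    then show ?thesis
      using small[of a c] small[of a b] max[of b] lM * t(3,4) by auto
  qed
  then consider "a = l" "subseq [b, c] (M # R)" | "a = M" "subseq [b, c] R" | "subseq [a, b, c] R"
    by (auto split: if_splits)
  then show "t \<in> {(l, M, r)}"
  proof cases
    case 1
    then consider "b = M" "c \<in> set R" | "b \<in> set R" "c \<in> set R"
      by (auto simp: subseq_singleton_left split: if_splits dest: set_subseq)
    then show ?thesis
    proof cases
      case 1
      then show ?thesis
        using R[of c] t \<open>a = l\<close> by auto
    next
      case 2
      then show ?thesis
        using R[of c] R[of b] t \<open>a = l\<close> by auto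
    qed
  next
    case 2
    then have "c \<in> set R"
      using set_subseq[OF 2(2)] by auto
    then show ?thesis
      using max[of c] 2 t by auto
  next
    case 3
    then have "(a, b, c) \<in> occ132 R"
      using t(3,4) by (simp add: occ132_def)
    then show ?thesis
      by (simp add: occ(2))
  qed
next
  fix t assume "t \<in> {(l, M, r)}"
  then show "t \<in> occ132 (L @ l # M # R)"
    using occ132_split_max_nonempty[of l "L @ [l]" r R M] lr max[of r] by simp
qed

text \<open>Every pair \<open>l < r\<close> with \<open>l\<close> left and \<open>r\<close> right of
  \<open>M\<close> yields the occurrence \<open>(l, M, r)\<close>. So there is just one such pair,
  and this places all other letters relative to \<open>l\<close> and \<open>r\<close>.\<close>

lemma single_occ132_crossingE:
  assumes dist: "distinct (L @ M # R)" and max: "\<And>x. x \<in> set L \<union> set R \<Longrightarrow> x < M"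
    and one: "card (occ132 (L @ M # R)) = 1"
    and nsep: "\<not> (\<forall>l\<in>set L. \<forall>r\<in>set R. r < l)"
  obtains L' l r where "L = L' @ [l]" "l < r" "r \<in> set R" "\<forall>x\<in>set L'. r < x"
    "\<forall>y\<in>set R. y \<noteq> r \<longrightarrow> y < l" "occ132 L' = {}" "occ132 R = {}"
proof -
  obtain l r where lr: "l \<in> set L" "r \<in> set R" "\<not> r < l"
    using nsep by blast
  then have less: "l < r"
    using dist by (metis distinct_append disjoint_iff linorder_neqE_nat list.set_intros(2))
  have "(l, M, r) \<in> occ132 (L @ M # R)"
    using lr max less by (intro occ132_split_max_nonempty) auto
  then have occ: "occ132 (L @ M # R) = {(l, M, r)}"
    using one by (metis card_1_singletonE singletonD)
  have uniq: "l' = l \<and> r' = r" if "l' \<in> set L" "r' \<in> set R" "l' < r'" for l' r'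
    using occ132_split_max_nonempty[OF that, of M] max[of r'] that(2) occ by auto
  obtain L1 L2 where L: "L = L1 @ l # L2"
    using lr(1) by (auto simp: in_set_conv_decomp)
  have ne: "x \<noteq> l \<and> x \<noteq> r" if "x \<in> set L1 \<union> set L2" for x
    using dist L that lr(2) by auto
  have above: "r < x" if "x \<in> set L1 \<union> set L2" for x
    using uniq[of x r] that L lr(2) ne[OF that] by (metis Un_iff in_set_conv_decomp linorder_neqE_nat set_append list.set_intros(2))
  \<comment> \<open>A letter \<open>x\<close> of \<open>L\<close> after \<open>l\<close> would
    exceed \<open>r\<close> and make \<open>(l, x, r)\<close> a second occurrence.\<close>
  have "L2 = []"
  proof (rule ccontr)
    assume "L2 \<noteq> []"
    then obtain x where x: "x \<in> set L2"
      using hd_in_set by blast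
    then have "subseq [l, x] L" "x \<in> set L"
      by (auto simp: L subseq_singleton_left intro: subseq_drop_many)
    then have "(l, x, r) \<in> occ132 (L @ M # R)"
      using lr less above[of x] x by (auto simp: occ132_def subseq3_append_iff)
    then show False
      using occ max[of x] x L by auto
  qed
  \<comment> \<open>An occurrence inside \<open>L1\<close> or \<open>R\<close> would have to be
    \<open>(l, M, r)\<close>, but \<open>M\<close> is a letter of neither.\<close>
  moreover have sub: "occ132 L1 = {}" "occ132 R = {}"
  proof -
    have "occ132 L1 \<subseteq> occ132 (L @ M # R)" "occ132 R \<subseteq> occ132 (L @ M # R)"
      by (auto simp: occ132_def L intro: subseq_rev_drop_many subseq_drop_many)
    moreover have "(l, M, r) \<notin> occ132 L1" "(l, M, r) \<notin> occ132 R"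
      using occ132_subset[of L1] occ132_subset[of R] max[of M] L by auto
    ultimately show "occ132 L1 = {}" "occ132 R = {}"
      using occ by auto
  qed
  moreover have "y < l" if "y \<in> set R" "y \<noteq> r" for y
    using uniq[of l y] that lr(1) dist by (metis disjoint_iff distinct_append linorder_neqE_nat list.set_intros(2))
  ultimately show thesis
    using that[of L1 l r] L less lr(2) above by auto
qed

section \<open>Containment of 2-1-3-...-k around the maximum\<close>

lemma has213I:
  "subseq (a # b # w) xs \<Longrightarrow> b < a \<Longrightarrow> sorted_wrt (<) (a # w) \<Longrightarrow> length w = j \<Longrightarrow> has213 j xs"
  unfolding has213_def by blast

lemma has213E:
  assumes "has213 j xs"
  obtains a b w where "subseq (a # b # w) xs" "b < a" "sorted_wrt (<) (a # w)" "length w = j"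
  using assms unfolding has213_def by blast

lemma has213_subseq: "subseq xs ys \<Longrightarrow> has213 j xs \<Longrightarrow> has213 j ys"
  by (elim has213E) (rule has213I, erule subseq_order.order_trans)

lemma sorted_wrt_butlast: "sorted_wrt P xs \<Longrightarrow> sorted_wrt P (butlast xs)"
  by (simp add: butlast_conv_take sorted_wrt_take)

text \<open>Common core of both kinds of splitting. Here \<open>a\<close> lies in \<open>L\<close>,
  so a letter of \<open>w\<close> taken from \<open>T\<close> exceeds \<open>a\<close> and can only
  be \<open>M\<close>. Hence at most the last letter of \<open>w\<close> is taken from
  \<open>T\<close>, and \<open>butlast w\<close> stays in \<open>L\<close> unless \<open>b\<close>
  already lies in \<open>T\<close>.\<close>

lemma has213_append_above:
  fixes M :: nat
  assumes T: "\<And>x y. x \<in> set L \<Longrightarrow> y \<in> set T \<Longrightarrow> y \<noteq> M \<Longrightarrow> y < x"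
    and sub: "subseq xs1 L" "subseq xs2 T" "a # b # w = xs1 @ xs2" "xs1 \<noteq> []"
    and w: "sorted_wrt (<) (a # w)" "w \<noteq> []"
  shows "subseq (a # b # butlast w) L \<or> w = [M] \<and> subseq [b, M] T"
proof -
  from sub(3,4) obtain xs1' where xs1: "xs1 = a # xs1'"
    by (cases xs1) auto
  have aL: "a \<in> set L"
    using set_subseq[OF sub(1)] xs1 by simp
  have only_M: "y = M" if "y \<in> set w" "y \<in> set xs2" for y
  proof (rule ccontr)
    assume "y \<noteq> M"
    moreover have "y \<in> set T" "a < y"
      using set_subseq[OF sub(2)] w(1) that by auto
    ultimately show False
      using T[OF aL, of y] by simp
  qed
  have single: "v = [M]" if "v \<noteq> []" "\<And>y. y \<in> set v \<Longrightarrow> y = M" "sorted_wrt (<) v" for v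
    using that by (cases v; cases "tl v") auto
  have bw: "b # w = xs1' @ xs2"
    using sub(3) xs1 by simp
  show ?thesis
  proof (cases xs1')
    case Nil
    then have "w = [M]"
      using bw only_M w by (intro single) auto
    then show ?thesis
      using bw Nil sub(2) by simp
  next
    case (Cons b' w1)
    then have eq: "b' = b" "w = w1 @ xs2"
      using bw by auto
    show ?thesis
    proof (cases "xs2 = []")
      case True
      then have "subseq (a # b # w) L"
        using sub(1) xs1 Cons eq by simp
      moreover have "subseq (a # b # butlast w) (a # b # w)"
        by (simp add: prefix_imp_subseq prefixeq_butlast)
      ultimately show ?thesis
        by (meson subseq_order.order_trans)
    next
      case False
      then have "xs2 = [M]"
        using only_M w(1) eq by (intro single) (auto simp: sorted_wrt_append)
      then show ?thesis
        using sub(1) xs1 Cons eq by simp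
    qed
  qed
qed

lemma has213_snoc_above:
  assumes "has213 j L" "\<And>x. x \<in> set L \<Longrightarrow> x < M"
  shows "has213 (Suc j) (L @ [M])"
proof -
  obtain a b w where abw: "subseq (a # b # w) L" "b < a" "sorted_wrt (<) (a # w)" "length w = j"
    using assms(1) by (auto simp: has213_def)
  have "subseq (a # b # w @ [M]) (L @ [M])"
    using list_emb_append_mono[OF abw(1), of "[M]" "[M]"] by simp
  moreover have "sorted_wrt (<) (a # w @ [M])"
    using abw assms(2) set_subseq[OF abw(1)] by (auto simp: sorted_wrt_append)
  ultimately show ?thesis
    using abw(2,4) by (auto intro!: has213I[of a b "w @ [M]"])
qed

text \<open>For a pattern begun in \<open>L\<close> the maximum can serve as the last letter, which
  lowers the index by one. For \<open>R\<close> nothing is gained: \<open>M\<close> is too large to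
  be the 2 of a pattern that has a 3.\<close>

lemma has213_split_max:
  assumes max: "\<And>x. x \<in> set L \<union> set R \<Longrightarrow> x < M"
    and sep: "\<And>l r. l \<in> set L \<Longrightarrow> r \<in> set R \<Longrightarrow> r < l"
  shows "has213 (Suc j) (L @ M # R) \<longleftrightarrow> has213 j L \<or> has213 (Suc j) R"
proof
  assume "has213 (Suc j) (L @ M # R)"
  then obtain a b w where abw: "subseq (a # b # w) (L @ M # R)" "b < a"
      "sorted_wrt (<) (a # w)" "length w = Suc j"
    by (auto simp: has213_def)
  from abw(1) obtain xs1 xs2 where xs: "a # b # w = xs1 @ xs2" "subseq xs1 L" "subseq xs2 (M # R)"
    by (rule subseq_appendE)
  show "has213 j L \<or> has213 (Suc j) R"
  proof (cases "xs1 = []")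
    case True
    then have s: "subseq (a # b # w) (M # R)"
      using xs by simp
    obtain x where x: "x \<in> set w"
      using abw(4) by (cases w) auto
    then have "x \<in> insert M (set R)" "a < x"
      using set_subseq[OF s] abw(3) by auto
    then have "a \<noteq> M"
      using max[of x] by auto
    then show ?thesis
      using s abw by (intro disjI2 has213I[of a b w]) auto
  next
    case False
    have "subseq (a # b # butlast w) L \<or> w = [M] \<and> subseq [b, M] (M # R)"
      by (rule has213_append_above[OF _ xs(2,3,1) False abw(3)]) (use sep abw(4) in auto)
    \<comment> \<open>\<open>M\<close> stands first in \<open>M # R\<close> and does not recur, so
      no letter precedes it there.\<close>
    moreover have "\<not> subseq [b, M] (M # R)"
      using max[of M] by (auto simp: subseq_singleton_left dest: set_subseq)
    moreover have "sorted_wrt (<) (a # butlast w)"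
      using sorted_wrt_butlast[OF abw(3)] abw(4) by (cases w) auto
    ultimately show ?thesis
      using abw(2,4) by (intro disjI1 has213I[of a b "butlast w"]) auto
  qed
next
  have "subseq (L @ [M]) (L @ M # R)" "subseq R (L @ M # R)"
    by (auto simp: subseq_append' intro: subseq_drop_many)
  moreover assume "has213 j L \<or> has213 (Suc j) R"
  ultimately show "has213 (Suc j) (L @ M # R)"
    using has213_snoc_above[of j L M] max has213_subseq by (metis UnI1)
qed

text \<open>The index is at least 2 because \<open>x l M\<close> with \<open>x\<close> in
  \<open>L\<close> is an occurrence of 2-1-3. With two letters in \<open>w\<close> that shape is
  impossible, so a pattern begun in \<open>L\<close> has its \<open>b\<close> in
  \<open>L\<close>.\<close>

lemma has213_crossing:
  assumes max: "\<And>x. x \<in> set L \<union> set R \<Longrightarrow> x < M" and lM: "l < M"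
    and L: "\<And>x. x \<in> set L \<Longrightarrow> r < x" and lr: "l < r"
    and R: "\<And>y. y \<in> set R \<Longrightarrow> y \<noteq> r \<Longrightarrow> y < l"
  shows "has213 (Suc (Suc j)) (L @ l # M # R) \<longleftrightarrow> has213 (Suc j) L \<or> has213 (Suc (Suc j)) R"
proof
  assume "has213 (Suc (Suc j)) (L @ l # M # R)"
  then obtain a b w where abw: "subseq (a # b # w) (L @ l # M # R)" "b < a"
      "sorted_wrt (<) (a # w)" "length w = Suc (Suc j)"
    by (auto simp: has213_def)
  from abw(1) obtain xs1 xs2 where
    xs: "a # b # w = xs1 @ xs2" "subseq xs1 L" "subseq xs2 (l # M # R)"
    by (rule subseq_appendE)
  show "has213 (Suc j) L \<or> has213 (Suc (Suc j)) R"
  proof (cases "xs1 = []")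
    case True
    then have s: "subseq (a # b # w) (l # M # R)"
      using xs by simp
    obtain x y w' where w: "w = x # y # w'"
      using abw(4) by (auto simp: length_Suc_conv)
    then have xy: "a < x" "x < y"
      using abw(3) by auto
    have "y \<in> set (l # M # R)" "x \<in> set (l # M # R)"
      using set_subseq[OF s] w by auto
    then have "y \<le> M"
      using max[of y] lM by auto
    \<comment> \<open>If \<open>a = l\<close>, then \<open>b < l < M\<close> puts
      \<open>b # w\<close> inside \<open>R\<close>, where only \<open>r\<close> exceeds
      \<open>l\<close>; but \<open>x\<close> and \<open>y\<close> are two such letters.\<close>
    have "a \<noteq> l"
    proof
      assume "a = l"
      then have "subseq (b # w) (M # R)"
        using s by simp
      then have "subseq (b # w) R"
        using abw(2) \<open>a = l\<close> lM by simp
      then have "x \<in> set R" "y \<in> set R"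
        using set_subseq w by fastforce+
      then have "x = r" "y = r"
        using R[of x] R[of y] xy \<open>a = l\<close> by force+
      then show False
        using xy by simp
    qed
    moreover have "a \<noteq> M"
      using xy \<open>y \<le> M\<close> by simp
    ultimately show ?thesis
      using s abw by (intro disjI2 has213I[of a b w]) auto
  next
    case False
    have "subseq (a # b # butlast w) L \<or> w = [M] \<and> subseq [b, M] (l # M # R)"
    proof (rule has213_append_above[OF _ xs(2,3,1) False abw(3)])
      fix x y assume xy: "x \<in> set L" "y \<in> set (l # M # R)" "y \<noteq> M"
      then have "y \<le> r"
        using R[of y] lr by (cases "y = r") auto
      then show "y < x"
        using L[OF xy(1)] by simp
    qed (use abw(4) in auto)
    moreover have "sorted_wrt (<) (a # butlast w)"
      using sorted_wrt_butlast[OF abw(3)] abw(4) by (cases w) auto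
    ultimately show ?thesis
      using abw(2,4) by (intro disjI1 has213I[of a b "butlast w"]) auto
  qed
next
  have "subseq (L @ [M]) (L @ l # M # R)" "subseq R (L @ l # M # R)"
    using subseq_drop_many[of R R "L @ [l, M]"] by (auto simp: subseq_append')
  moreover assume "has213 (Suc j) L \<or> has213 (Suc (Suc j)) R"
  ultimately show "has213 (Suc (Suc j)) (L @ l # M # R)"
    using has213_snoc_above[of "Suc j" L M] max has213_subseq by (metis UnI1)
qed

text \<open>Used to see that the length of \<open>L\<close> alone fixes the letters on both sides of
  the maximum.\<close>

lemma initial_segment_split:
  fixes A B :: "nat set"
  assumes AB: "A \<union> B = {1..N}" and less: "\<And>a b. a \<in> A \<Longrightarrow> b \<in> B \<Longrightarrow> a < b"
  shows "A = {1..card A}" "B = {card A + 1..N}"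
proof -
  have fin: "finite A"
    using AB by (metis finite_Un finite_atLeastAtMost)
  have "A = {1..card A}"
  proof (cases "A = {}")
    case False
    have "A = {1..Max A}"
    proof (intro equalityI subsetI)
      fix y assume y: "y \<in> {1..Max A}"
      have "Max A \<in> A"
        using fin False by simp
      then have "Max A \<le> N"
        using AB by auto
      then have "y \<in> A \<union> B"
        unfolding AB using y by simp
      then show "y \<in> A"
        using y less[OF \<open>Max A \<in> A\<close>, of y] by auto
    qed (use AB fin in auto)
    then show ?thesis
      by (metis card_atLeastAtMost diff_Suc_1)
  qed simp
  then show "A = {1..card A}" .
  have "A \<inter> B = {}"
    using less by blast
  then have "B = {1..N} - A"
    using AB by blast
  then show "B = {card A + 1..N}"
    by (subst (asm) \<open>A = {1..card A}\<close>) auto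
qed

section \<open>Counting the two kinds of splittings\<close>

text \<open>The parity of the length is left out, since the splittings treat odd and even words
  alike; it is imposed afterwards.\<close>

definition good :: "nat \<Rightarrow> nat \<Rightarrow> nat list \<Rightarrow> bool" where
  "good c j xs \<longleftrightarrow> alternating_up xs \<and> card (occ132 xs) = c \<and> \<not> has213 j xs"

lemma order_invariant_good: "order_invariant (good c j)"
  unfolding good_def
  by (intro order_invariant_conj order_invariant_alternating_up order_invariant_card_occ132
        order_invariant_not order_invariant_has213)

lemma order_invariant_parity_good:
  "order_invariant (\<lambda>xs. odd (length xs) \<and> good c j xs)"
  "order_invariant (\<lambda>xs. even (length xs) \<and> good c j xs)"
  by (intro order_invariant_conj order_invariant_length order_invariant_good)+

lemma num_perms_length_conj:
  "num_perms (\<lambda>xs. P (length xs) \<and> Q xs) n = (if P n then num_perms Q n else 0)"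
proof -
  have "{xs \<in> permutations_of_set {1..n}. P (length xs) \<and> Q xs} =
      (if P n then {xs \<in> permutations_of_set {1..n}. Q xs} else {})"
    using length_finite_permutations_of_set[of _ "{1..n}"] by auto
  then show ?thesis
    by (simp add: num_perms_def)
qed

section \<open>Letter sets and cardinalities of the two kinds of splittings\<close>

lemma permutation_split_max:
  fixes n :: nat
  assumes "xs \<in> permutations_of_set {1..n}" "n \<ge> 1"
  obtains L R where "xs = L @ n # R" "distinct (L @ n # R)" "set L \<union> set R = {1..n - 1}"
    "\<And>x. x \<in> set L \<union> set R \<Longrightarrow> x < n"
proof -
  have xs: "set xs = {1..n}" "distinct xs"
    using permutations_of_setD[OF assms(1)] by auto
  then have "n \<in> set xs"
    using assms(2) by simp
  then obtain L R where LR: "xs = L @ n # R"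
    by (auto simp: in_set_conv_decomp)
  then have d: "distinct (L @ n # R)"
    using xs by simp
  have "set L \<union> set R = {1..n} - {n}"
    using xs(1) d unfolding LR by auto
  also have "\<dots> = {1..n - 1}"
    by auto
  finally have "set L \<union> set R = {1..n - 1}" .
  moreover from this have "x < n" if "x \<in> set L \<union> set R" for x
    using that assms(2) by auto
  ultimately show thesis
    using that LR d by blast
qed

text \<open>If \<open>L\<close> has length \<open>i\<close>, it consists of the \<open>i\<close>
  largest letters below \<open>n\<close>, and \<open>R\<close> of the remaining ones.\<close>

lemma card_separated_permutations:
  assumes "order_invariant P" "order_invariant Q" "n \<ge> 1"
  shows "card {xs \<in> permutations_of_set {1..n}. \<exists>L R. xs = L @ n # R \<and>
             (\<forall>l\<in>set L. \<forall>r\<in>set R. r < l) \<and> P L \<and> Q R} =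
         (\<Sum>i<n. num_perms P i * num_perms Q (n - 1 - i))"
proof -
  have "{xs \<in> permutations_of_set {1..n}. \<exists>L R. xs = L @ n # R \<and>
             (\<forall>l\<in>set L. \<forall>r\<in>set R. r < l) \<and> P L \<and> Q R} =
     {(L @ []) @ n # R | i L R. i \<in> {..<n} \<and> L \<in> permutations_of_set {n - i..n - 1} \<and> P L \<and>
                  R \<in> permutations_of_set {1..n - 1 - i} \<and> Q R}" (is "?l = ?r")
  proof (intro equalityI subsetI)
    fix xs assume xs: "xs \<in> ?l"
    then obtain L R where LR: "xs = L @ n # R" "\<forall>l\<in>set L. \<forall>r\<in>set R. r < l" "P L" "Q R"
      by blast
    have "distinct (L @ n # R)" "set (L @ n # R) = {1..n}"
      using xs LR(1) by (auto simp: permutations_of_set_def)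
    moreover have "{1..n} - {n} = {1..n - 1}"
      by auto
    ultimately have d: "distinct L" "distinct R" "set R \<union> set L = {1..n - 1}" "set L \<inter> set R = {}"
      by auto
    have s: "set R = {1..card (set R)}" "set L = {card (set R) + 1..n - 1}"
      using initial_segment_split[OF d(3)] LR(2) by blast+
    have "card (set R) + card (set L) = n - 1"
      using d(3,4) card_Un_disjoint[of "set R" "set L"] by (simp add: Int_commute)
    then have c: "card (set L) < n" "card (set R) = n - 1 - card (set L)"
        "n - 1 - card (set L) + 1 = n - card (set L)"
      using assms(3) by auto
    have "card (set L) \<in> {..<n}" "L \<in> permutations_of_set {n - card (set L)..n - 1}"
        "R \<in> permutations_of_set {1..n - 1 - card (set L)}"
      using c(1) s[unfolded c(2,3)] d(1,2) by (auto intro: permutations_of_setI)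
    then show "xs \<in> ?r"
      unfolding mem_Collect_eq append_Nil2 using LR(1,3,4) by blast
  next
    fix xs assume "xs \<in> ?r"
    then obtain i L R where "xs = L @ n # R" "i < n" and
      LR: "L \<in> permutations_of_set {n - i..n - 1}" "P L" "R \<in> permutations_of_set {1..n - 1 - i}" "Q R"
      by auto
    moreover have "set L = {n - i..n - 1}" "distinct L" "set R = {1..n - 1 - i}" "distinct R"
      using permutations_of_setD LR by blast+
    moreover from calculation have "set (L @ n # R) = {1..n}" "distinct (L @ n # R)"
      using assms(3) by auto
    moreover from calculation have "\<forall>l\<in>set L. \<forall>r\<in>set R. r < l"
      by auto
    ultimately show "xs \<in> ?l"
      using permutations_of_setI by blast
  qed
  also have "card \<dots> = (\<Sum>i\<in>{..<n}. num_perms P i * num_perms Q (card {1..n - 1 - i}))"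
    by (rule card_split_at_max[OF assms(1,2), where c = 0]) (use assms(3) in auto)
  finally show ?thesis
    by simp
qed

text \<open>If \<open>L\<close> has length \<open>i\<close> and \<open>R\<close> has length
  \<open>q\<close>, then \<open>n = i + q + 2\<close>, and the conditions force \<open>l = q\<close>
  and \<open>r = q + 1\<close>. The bound \<open>i < n - 2\<close> says that \<open>R\<close> is
  nonempty, as it contains \<open>r\<close>.\<close>

lemma card_crossing_permutations:
  assumes "order_invariant P" "order_invariant Q"
  shows "card {xs \<in> permutations_of_set {1..n}. \<exists>L l r R. xs = L @ l # n # R \<and> l < r \<and> r \<in> set R \<and>
             (\<forall>x\<in>set L. r < x) \<and> (\<forall>y\<in>set R. y \<noteq> r \<longrightarrow> y < l) \<and> P L \<and> Q R} =
         (\<Sum>i<n - 2. num_perms P i * num_perms Q (n - 2 - i))"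
proof -
  \<comment> \<open>The letters of \<open>R\<close>: first \<open>r = n - 1 - i\<close>, then
    everything below \<open>l = n - 2 - i\<close>.\<close>
  define B where "B i = insert (n - 1 - i) {1..n - 3 - i}" for i
  have "{xs \<in> permutations_of_set {1..n}. \<exists>L l r R. xs = L @ l # n # R \<and> l < r \<and> r \<in> set R \<and>
             (\<forall>x\<in>set L. r < x) \<and> (\<forall>y\<in>set R. y \<noteq> r \<longrightarrow> y < l) \<and> P L \<and> Q R} =
     {(L @ [n - 2 - i]) @ n # R | i L R. i \<in> {..<n - 2} \<and> L \<in> permutations_of_set {n - i..n - 1} \<and> P L \<and>
                  R \<in> permutations_of_set (B i) \<and> Q R}" (is "?l = ?r")
  proof (intro equalityI subsetI)
    fix xs assume xs: "xs \<in> ?l"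
    then obtain L l r R where LR: "xs = L @ l # n # R" "l < r" "r \<in> set R" "\<forall>x\<in>set L. r < x"
        "\<forall>y\<in>set R. y \<noteq> r \<longrightarrow> y < l" "P L" "Q R"
      by blast
    have "distinct (L @ l # n # R)" "set (L @ l # n # R) = {1..n}"
      using xs LR(1) by (auto simp: permutations_of_set_def)
    moreover have "{1..n} - {n} = {1..n - 1}"
      by auto
    ultimately have d: "distinct L" "distinct R" "insert l (set R) \<union> set L = {1..n - 1}"
        "insert l (set R) \<inter> set L = {}" "l \<notin> set R"
      by auto
    define q where "q = card (set R)"
    have q: "card (insert l (set R)) = q + 1"
      using d(5) by (simp add: q_def)
    have lt: "a < b" if "a \<in> insert l (set R)" "b \<in> set L" for a b
    proof -
      have "a \<le> r"
        using that(1) LR(2,5) by (cases "a = r") auto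
      then show ?thesis
        using LR(4) that(2) by force
    qed
    have s: "insert l (set R) = {1..q + 1}" "set L = {q + 2..n - 1}"
      using initial_segment_split[OF d(3) lt] unfolding q by simp_all
    \<comment> \<open>A second split, inside \<open>{1..q + 1}\<close>: the letters of
      \<open>R\<close> other than \<open>r\<close> lie below both \<open>l\<close> and
      \<open>r\<close>, so this pair is on top.\<close>
    have "(set R - {r}) \<union> {l, r} = {1..q + 1}"
      using s(1) LR(3) by auto
    moreover have "a < b" if "a \<in> set R - {r}" "b \<in> {l, r}" for a b
      using that LR(2,5) by auto
    ultimately have s2: "set R - {r} = {1..card (set R - {r})}" "{l, r} = {card (set R - {r}) + 1..q + 1}"
      using initial_segment_split[of "set R - {r}" "{l, r}" "q + 1"] by blast+
    have "card (set R - {r}) = q - 1" "q \<ge> 1"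
      using LR(3) by (auto simp: q_def Suc_le_eq card_gt_0_iff)
    then have s3: "set R - {r} = {1..q - 1}" "{l, r} = {q, q + 1}"
      using s2 by auto
    have lr: "l = q" "r = q + 1"
      using s3(2) LR(2) by (auto simp: doubleton_eq_iff)
    have "card (insert l (set R)) + card (set L) = n - 1"
      using d(3,4) card_Un_disjoint[of "insert l (set R)" "set L"] by simp
    then have i: "card (set L) + q + 2 = n"
      using q \<open>q \<ge> 1\<close> by simp
    define i where "i = card (set L)"
    have ni: "n = i + q + 2"
      using i by (simp add: i_def)
    have "set R = B i"
      using s3(1) LR(3) \<open>q \<ge> 1\<close> unfolding lr B_def ni by auto
    moreover have "set L = {n - i..n - 1}"
      using s(2) unfolding ni by simp
    moreover have "i < n - 2" "l = n - 2 - i"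
      using \<open>q \<ge> 1\<close> lr unfolding ni by simp_all
    ultimately show "xs \<in> ?r"
    proof -
      assume *: "set R = B i" "set L = {n - i..n - 1}" "i < n - 2" "l = n - 2 - i"
      then have "i \<in> {..<n - 2}" "L \<in> permutations_of_set {n - i..n - 1}" "R \<in> permutations_of_set (B i)"
        using d(1,2) by (simp_all add: permutations_of_set_def)
      moreover have "xs = (L @ [n - 2 - i]) @ n # R"
        using LR(1) *(4) by simp
      ultimately show ?thesis
        using LR(6,7) by blast
    qed
  next
    fix xs assume "xs \<in> ?r"
    then obtain i L R where "xs = L @ (n - 2 - i) # n # R" "i < n - 2" and
      LR: "L \<in> permutations_of_set {n - i..n - 1}" "P L" "R \<in> permutations_of_set (B i)" "Q R"
      by auto
    moreover define q where "q = n - 2 - i"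
    ultimately have q: "xs = L @ q # n # R" "n = i + q + 2" "q \<ge> 1"
      by auto
    have "set L = {n - i..n - 1}" "distinct L" "set R = B i" "distinct R"
      using permutations_of_setD LR by blast+
    then have s: "set L = {q + 2..n - 1}" "distinct L" "set R = insert (q + 1) {1..q - 1}" "distinct R"
      by (auto simp: q(2) B_def)
    then have "set xs = {1..n}" "distinct xs"
      unfolding q(1) using q(2,3) by auto
    then have "xs \<in> permutations_of_set {1..n}"
      by (rule permutations_of_setI)
    moreover have "q < q + 1" "q + 1 \<in> set R" "\<forall>x\<in>set L. q + 1 < x" "\<forall>y\<in>set R. y \<noteq> q + 1 \<longrightarrow> y < q"
      using s(1,3) q(3) by auto
    ultimately show "xs \<in> ?l"
      using LR(2,4) q(1) by blast
  qed
  also have "card \<dots> = (\<Sum>i\<in>{..<n - 2}. num_perms P i * num_perms Q (card (B i)))"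
    by (rule card_split_at_max[OF assms, where c = 1]) (auto simp: B_def)
  also have "\<dots> = (\<Sum>i<n - 2. num_perms P i * num_perms Q (n - 2 - i))"
    by (intro sum.cong refl arg_cong2[where f = "(*)"] arg_cong[where f = "num_perms Q"])
       (auto simp: B_def card_insert_if)
  finally show ?thesis .
qed

section \<open>Recurrences for the number of good words\<close>

lemma occ132_short: "length xs \<le> 1 \<Longrightarrow> occ132 xs = {}"
  by (auto simp: occ132_def)

text \<open>The letter sets of \<open>L\<close> and \<open>R\<close> are disjoint, so the numbers of
  occurrences add; \<open>c1\<close> and \<open>c2\<close> record their shares.\<close>

lemma good_split_max:
  assumes d: "distinct (L @ M # R)" and max: "\<And>x. x \<in> set L \<union> set R \<Longrightarrow> x < M"
    and sep: "\<And>l r. l \<in> set L \<Longrightarrow> r \<in> set R \<Longrightarrow> r < l" and ne: "L \<noteq> [] \<or> R \<noteq> []"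
  shows "good c (Suc j) (L @ M # R) \<longleftrightarrow>
    (\<exists>c1 c2. c1 + c2 = c \<and> (odd (length L) \<and> good c1 j L) \<and> good c2 (Suc j) R)"
proof -
  have "occ132 L \<inter> occ132 R = {}"
    using occ132_subset[of L] occ132_subset[of R] d by fastforce
  moreover have "occ132 (L @ M # R) = occ132 L \<union> occ132 R"
    using max sep by (rule occ132_split_max)
  ultimately have occ: "card (occ132 (L @ M # R)) = card (occ132 L) + card (occ132 R)"
    by (simp add: card_Un_disjoint finite_occ132)
  have pat: "has213 (Suc j) (L @ M # R) \<longleftrightarrow> has213 j L \<or> has213 (Suc j) R"
    using max sep by (rule has213_split_max)
  have alt: "alternating_up (L @ M # R) \<longleftrightarrow> odd (length L) \<and> alternating_up L \<and> alternating_up R"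
    using max ne by (rule alternating_up_split_max)
  show ?thesis
    unfolding good_def occ pat alt by auto
qed

definition separated_at :: "nat \<Rightarrow> nat list \<Rightarrow> bool" where
  "separated_at n xs \<longleftrightarrow> (\<exists>L R. xs = L @ n # R \<and> (\<forall>l\<in>set L. \<forall>r\<in>set R. r < l))"

lemma good_separated_iff:
  assumes "n \<ge> 2" "xs \<in> permutations_of_set {1..n}"
  shows "good c (Suc j) xs \<and> separated_at n xs \<longleftrightarrow>
    (\<exists>c1 c2. c1 + c2 = c \<and> (\<exists>L R. xs = L @ n # R \<and> (\<forall>l\<in>set L. \<forall>r\<in>set R. r < l) \<and>
       (odd (length L) \<and> good c1 j L) \<and> good c2 (Suc j) R))"
proof -
  obtain L R where LR: "xs = L @ n # R" "distinct (L @ n # R)" "set L \<union> set R = {1..n - 1}"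
      "\<And>x. x \<in> set L \<union> set R \<Longrightarrow> x < n"
    using permutation_split_max[OF assms(2)] assms(1) by auto
  have ne: "L \<noteq> [] \<or> R \<noteq> []"
    using LR(3) assms(1) by auto
  have uniq: "xs = L' @ n # R' \<longleftrightarrow> L' = L \<and> R' = R" for L' R'
    using append_Cons_eq_iff[of n L R L' R'] LR(1,2) by auto
  have "good c (Suc j) xs \<longleftrightarrow>
      (\<exists>c1 c2. c1 + c2 = c \<and> (odd (length L) \<and> good c1 j L) \<and> good c2 (Suc j) R)"
    if "\<forall>l\<in>set L. \<forall>r\<in>set R. r < l"
    unfolding LR(1) using LR(2,4) that ne by (intro good_split_max) blast+
  then show ?thesis
    unfolding separated_at_def uniq by auto
qed

lemma occ132_nonempty_if_not_separated:
  assumes "n \<ge> 1" "xs \<in> permutations_of_set {1..n}" "\<not> separated_at n xs"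
  shows "occ132 xs \<noteq> {}"
proof -
  obtain L R where LR: "xs = L @ n # R" "distinct (L @ n # R)" "set L \<union> set R = {1..n - 1}"
      "\<And>x. x \<in> set L \<union> set R \<Longrightarrow> x < n"
    using permutation_split_max[OF assms(2,1)] by metis
  obtain l r where lr: "l \<in> set L" "r \<in> set R" "\<not> r < l"
    using assms(3) LR(1) unfolding separated_at_def by blast
  then have "l \<noteq> r"
    using LR(2) by auto
  then have "(l, n, r) \<in> occ132 (L @ n # R)"
    using lr LR(4)[of r] by (intro occ132_split_max_nonempty) auto
  then show ?thesis
    using LR(1) by auto
qed

text \<open>Without an occurrence of 1-3-2 only the separated splitting is possible. Length 1 must
  be excluded: there \<open>L\<close> is empty and the sum is 0, but the word is good.\<close>

lemma num_good_0_rec: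
  assumes "n \<ge> 2"
  shows "num_perms (good 0 (Suc j)) n =
    (\<Sum>i<n. (if odd i then num_perms (good 0 j) i else 0) * num_perms (good 0 (Suc j)) (n - 1 - i))"
proof -
  have "good 0 (Suc j) xs \<longleftrightarrow> (\<exists>L R. xs = L @ n # R \<and> (\<forall>l\<in>set L. \<forall>r\<in>set R. r < l) \<and>
       (odd (length L) \<and> good 0 j L) \<and> good 0 (Suc j) R)"
    if "xs \<in> permutations_of_set {1..n}" for xs
  proof -
    have "separated_at n xs" if "good 0 (Suc j) xs"
      using occ132_nonempty_if_not_separated[of n xs] assms that finite_occ132[of xs]
        \<open>xs \<in> permutations_of_set {1..n}\<close> by (auto simp: good_def)
    then show ?thesis
      using good_separated_iff[OF assms that, of 0 j] by auto
  qed
  then have "num_perms (good 0 (Suc j)) n = card {xs \<in> permutations_of_set {1..n}.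
      \<exists>L R. xs = L @ n # R \<and> (\<forall>l\<in>set L. \<forall>r\<in>set R. r < l) \<and>
       (odd (length L) \<and> good 0 j L) \<and> good 0 (Suc j) R}"
    unfolding num_perms_def by (intro arg_cong[where f = card]) blast
  also have "\<dots> = (\<Sum>i<n. num_perms (\<lambda>xs. odd (length xs) \<and> good 0 j xs) i *
                         num_perms (good 0 (Suc j)) (n - 1 - i))"
    using assms by (intro card_separated_permutations order_invariant_parity_good order_invariant_good) simp
  finally show ?thesis
    by (simp only: num_perms_length_conj[of odd])
qed

text \<open>Here the only occurrence has \<open>n\<close> as its 3: a letter left of
  \<open>n\<close> and a larger one right of it form one together with \<open>n\<close>.\<close>

definition crossing :: "nat \<Rightarrow> nat \<Rightarrow> nat list set" where
  "crossing j n = {xs \<in> permutations_of_set {1..n}. good 1 j xs \<and> \<not> separated_at n xs}"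

text \<open>The three terms count the words whose single occurrence lies left of \<open>n\<close>,
  lies right of \<open>n\<close>, or crosses \<open>n\<close>.\<close>

lemma num_good_1_rec:
  assumes "n \<ge> 2"
  shows "num_perms (good 1 (Suc j)) n =
    (\<Sum>i<n. (if odd i then num_perms (good 1 j) i else 0) * num_perms (good 0 (Suc j)) (n - 1 - i)) +
    (\<Sum>i<n. (if odd i then num_perms (good 0 j) i else 0) * num_perms (good 1 (Suc j)) (n - 1 - i)) +
    card (crossing (Suc j) n)"
proof -
  define A where "A c1 c2 xs \<longleftrightarrow> (\<exists>L R. xs = L @ n # R \<and> (\<forall>l\<in>set L. \<forall>r\<in>set R. r < l) \<and>
       (odd (length L) \<and> good c1 j L) \<and> good c2 (Suc j) R)" for c1 c2 xs
  define S where "S c1 c2 = {xs \<in> permutations_of_set {1..n}. A c1 c2 xs}" for c1 c2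
  have S: "card (S c1 c2) = (\<Sum>i<n. (if odd i then num_perms (good c1 j) i else 0) *
      num_perms (good c2 (Suc j)) (n - 1 - i))" for c1 c2
  proof -
    have "card (S c1 c2) = (\<Sum>i<n. num_perms (\<lambda>xs. odd (length xs) \<and> good c1 j xs) i *
                         num_perms (good c2 (Suc j)) (n - 1 - i))"
      unfolding S_def A_def using assms
      by (intro card_separated_permutations order_invariant_parity_good order_invariant_good) simp
    then show ?thesis
      by (simp only: num_perms_length_conj[of odd])
  qed
  have fin: "finite (S c1 c2)" "finite (crossing (Suc j) n)" for c1 c2
    by (simp_all add: S_def crossing_def)
  have sums: "c1 + c2 = 1 \<longleftrightarrow> c1 = 1 \<and> c2 = 0 \<or> c1 = 0 \<and> c2 = (1::nat)" for c1 c2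
    by auto
  have "good 1 (Suc j) xs \<and> separated_at n xs \<longleftrightarrow> A 1 0 xs \<or> A 0 1 xs"
    if "xs \<in> permutations_of_set {1..n}" for xs
    unfolding good_separated_iff[OF assms that] sums A_def[symmetric] by blast
  then have "{xs \<in> permutations_of_set {1..n}. good 1 (Suc j) xs \<and> separated_at n xs} = S 1 0 \<union> S 0 1"
    unfolding S_def by blast
  then have eq: "{xs \<in> permutations_of_set {1..n}. good 1 (Suc j) xs} =
      S 1 0 \<union> S 0 1 \<union> crossing (Suc j) n"
    unfolding crossing_def by blast
  \<comment> \<open>The splitting at \<open>n\<close> is unique, so the same \<open>L\<close> would
    have both one occurrence and none.\<close>
  have "S 1 0 \<inter> S 0 1 = {}"
  proof (rule equals0I)
    fix xs assume "xs \<in> S 1 0 \<inter> S 0 1"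
    then obtain L R L' R' where *: "xs = L @ n # R" "xs = L' @ n # R'" "good 1 j L" "good 0 j L'"
        "xs \<in> permutations_of_set {1..n}"
      unfolding S_def A_def by blast
    then have "distinct (L @ n # R)"
      by (auto simp: permutations_of_set_def)
    then have "L = L'"
      using * append_Cons_eq_iff[of n L R L' R'] by auto
    then show False
      using * by (simp add: good_def)
  qed
  moreover have "(S 1 0 \<union> S 0 1) \<inter> crossing (Suc j) n = {}"
    by (auto simp: S_def A_def crossing_def separated_at_def)
  ultimately have "num_perms (good 1 (Suc j)) n = card (S 1 0) + card (S 0 1) + card (crossing (Suc j) n)"
    unfolding num_perms_def eq using fin by (simp add: card_Un_disjoint)
  then show ?thesis
    unfolding S .
qed

lemma mem_crossing_iff:
  "xs \<in> crossing j n \<longleftrightarrow> xs \<in> permutations_of_set {1..n} \<and> good 1 j xs \<and>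
     (\<exists>L l r R. xs = L @ l # n # R \<and> l < r \<and> r \<in> set R \<and> (\<forall>x\<in>set L. r < x) \<and>
        (\<forall>y\<in>set R. y \<noteq> r \<longrightarrow> y < l) \<and> occ132 L = {} \<and> occ132 R = {})"
proof
  assume xs: "xs \<in> crossing j n"
  then have "n \<noteq> 0"
    by (intro notI) (auto simp: crossing_def good_def occ132_short)
  then have "n \<ge> 1"
    by simp
  obtain L R where LR: "xs = L @ n # R" "distinct (L @ n # R)" "set L \<union> set R = {1..n - 1}"
      "\<And>x. x \<in> set L \<union> set R \<Longrightarrow> x < n"
    by (rule permutation_split_max[OF _ \<open>n \<ge> 1\<close>]) (use xs in \<open>auto simp: crossing_def\<close>)
  have one: "card (occ132 (L @ n # R)) = 1" and nsep: "\<not> (\<forall>l\<in>set L. \<forall>r\<in>set R. r < l)"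
    using xs LR(1) by (auto simp: crossing_def good_def separated_at_def)
  obtain L' l r where
    "L = L' @ [l]" "l < r" "r \<in> set R" "\<forall>x\<in>set L'. r < x"
    "\<forall>y\<in>set R. y \<noteq> r \<longrightarrow> y < l" "occ132 L' = {}" "occ132 R = {}"
    using LR(2,4) one nsep by (rule single_occ132_crossingE)
  moreover from this have "xs = L' @ l # n # R"
    using LR(1) by simp
  ultimately show "xs \<in> permutations_of_set {1..n} \<and> good 1 j xs \<and>
     (\<exists>L l r R. xs = L @ l # n # R \<and> l < r \<and> r \<in> set R \<and> (\<forall>x\<in>set L. r < x) \<and>
        (\<forall>y\<in>set R. y \<noteq> r \<longrightarrow> y < l) \<and> occ132 L = {} \<and> occ132 R = {})"
    using xs unfolding crossing_def by blast
next
  assume "xs \<in> permutations_of_set {1..n} \<and> good 1 j xs \<and>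
     (\<exists>L l r R. xs = L @ l # n # R \<and> l < r \<and> r \<in> set R \<and> (\<forall>x\<in>set L. r < x) \<and>
        (\<forall>y\<in>set R. y \<noteq> r \<longrightarrow> y < l) \<and> occ132 L = {} \<and> occ132 R = {})"
  then obtain L l r R where xs: "xs \<in> permutations_of_set {1..n}" "good 1 j xs"
      "xs = L @ l # n # R" "l < r" "r \<in> set R"
    by blast
  have "distinct ((L @ [l]) @ n # R)"
    using xs by (auto simp: permutations_of_set_def)
  then have uniq: "xs = L' @ n # R' \<longleftrightarrow> L' = L @ [l] \<and> R' = R" for L' R'
    using append_Cons_eq_iff[of n "L @ [l]" R L' R'] xs(3) by auto
  have "\<not> separated_at n xs"
  proof
    assume "separated_at n xs"
    then have "\<forall>l\<in>set (L @ [l]). \<forall>r\<in>set R. r < l"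
      unfolding separated_at_def uniq by blast
    then have "r < l"
      using xs(5) by simp
    then show False
      using xs(4) by simp
  qed
  then show "xs \<in> crossing j n"
    using xs by (simp add: crossing_def)
qed

text \<open>The maximum needs the odd word \<open>L @ [l]\<close> in front of it, and the final
  descent to \<open>l\<close> is automatic because \<open>l\<close> lies below \<open>L\<close>. The
  one occurrence is \<open>(l, M, r)\<close>, so none is left for \<open>L\<close> and
  \<open>R\<close>.\<close>

lemma good_crossing_iff:
  assumes max: "\<And>x. x \<in> set L \<union> set R \<Longrightarrow> x < M" and lM: "l < M"
    and L: "\<And>x. x \<in> set L \<Longrightarrow> r < x" and lr: "l < r" "r \<in> set R"
    and R: "\<And>y. y \<in> set R \<Longrightarrow> y \<noteq> r \<Longrightarrow> y < l"
  shows "good 1 (Suc (Suc j)) (L @ l # M # R) \<and> occ132 L = {} \<and> occ132 R = {} \<longleftrightarrow>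
    (even (length L) \<and> good 0 (Suc j) L) \<and> good 0 (Suc (Suc j)) R"
proof -
  have "alternating_up ((L @ [l]) @ M # R) \<longleftrightarrow>
      odd (length (L @ [l])) \<and> alternating_up (L @ [l]) \<and> alternating_up R"
    using max lM by (intro alternating_up_split_max) auto
  also have "\<dots> \<longleftrightarrow> even (length L) \<and> alternating_up L \<and> alternating_up R"
    using alternating_up_snoc_below[of L l] L lr(1) by (auto dest: less_trans)
  finally have alt: "alternating_up (L @ l # M # R) \<longleftrightarrow>
      even (length L) \<and> alternating_up L \<and> alternating_up R"
    by simp
  have "occ132 (L @ l # M # R) = {(l, M, r)}" if "occ132 L = {}" "occ132 R = {}"
    using max lM L lr R that by (rule occ132_crossing)
  moreover have "has213 (Suc (Suc j)) (L @ l # M # R) \<longleftrightarrow> has213 (Suc j) L \<or> has213 (Suc (Suc j)) R"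
    using max lM L lr(1) R by (rule has213_crossing)
  ultimately show ?thesis
    unfolding good_def alt by (auto simp: finite_occ132)
qed

lemma card_crossing:
  "card (crossing (Suc (Suc j)) n) =
    (\<Sum>i<n - 2. (if even i then num_perms (good 0 (Suc j)) i else 0) *
       num_perms (good 0 (Suc (Suc j))) (n - 2 - i))"
proof -
  have eq: "crossing (Suc (Suc j)) n =
    {xs \<in> permutations_of_set {1..n}. \<exists>L l r R. xs = L @ l # n # R \<and> l < r \<and> r \<in> set R \<and>
       (\<forall>x\<in>set L. r < x) \<and> (\<forall>y\<in>set R. y \<noteq> r \<longrightarrow> y < l) \<and>
       (even (length L) \<and> good 0 (Suc j) L) \<and> good 0 (Suc (Suc j)) R}" (is "_ = ?rhs")
  proof -
    have iff: "good 1 (Suc (Suc j)) xs \<and> occ132 L = {} \<and> occ132 R = {} \<longleftrightarrow>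
        (even (length L) \<and> good 0 (Suc j) L) \<and> good 0 (Suc (Suc j)) R"
      if "xs \<in> permutations_of_set {1..n}" "xs = L @ l # n # R" "l < r" "r \<in> set R"
        "\<forall>x\<in>set L. r < x" "\<forall>y\<in>set R. y \<noteq> r \<longrightarrow> y < l" for xs L l r R
    proof -
      have "distinct (L @ l # n # R)" "set (L @ l # n # R) = {1..n}"
        using that(1,2) by (auto simp: permutations_of_set_def)
      then have "n \<notin> set L \<union> set R \<union> {l}" "set L \<union> set R \<union> {l} \<subseteq> {1..n}"
        by auto
      then have lt: "x < n" if "x \<in> set L \<union> set R \<union> {l}" for x
        using that by (metis atLeastAtMost_iff le_neq_implies_less subsetD)
      show ?thesis
        unfolding that(2) by (rule good_crossing_iff[where r = r]) (use lt that in auto)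
    qed
    show ?thesis
    proof (intro equalityI subsetI)
      fix xs assume "xs \<in> crossing (Suc (Suc j)) n"
      then obtain L l r R where xs: "xs \<in> permutations_of_set {1..n}" "good 1 (Suc (Suc j)) xs"
          "occ132 L = {}" "occ132 R = {}" and
        LR: "xs = L @ l # n # R" "l < r" "r \<in> set R" "\<forall>x\<in>set L. r < x" "\<forall>y\<in>set R. y \<noteq> r \<longrightarrow> y < l"
        unfolding mem_crossing_iff by blast
      show "xs \<in> ?rhs"
        using iff[OF xs(1) LR] xs LR by blast
    next
      fix xs assume "xs \<in> ?rhs"
      then obtain L l r R where xs: "xs \<in> permutations_of_set {1..n}"
          "(even (length L) \<and> good 0 (Suc j) L) \<and> good 0 (Suc (Suc j)) R" and
        LR: "xs = L @ l # n # R" "l < r" "r \<in> set R" "\<forall>x\<in>set L. r < x" "\<forall>y\<in>set R. y \<noteq> r \<longrightarrow> y < l"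
        by blast
      show "xs \<in> crossing (Suc (Suc j)) n"
        using iff[OF xs(1) LR] xs LR unfolding mem_crossing_iff by blast
    qed
  qed
  have "card (crossing (Suc (Suc j)) n) = (\<Sum>i<n - 2. num_perms (\<lambda>xs. even (length xs) \<and> good 0 (Suc j) xs) i *
      num_perms (good 0 (Suc (Suc j))) (n - 2 - i))"
    unfolding eq by (intro card_crossing_permutations order_invariant_parity_good order_invariant_good)
  then show ?thesis
    unfolding num_perms_length_conj[of even "good 0 (Suc j)"] .
qed

text \<open>The case of 2-1-3, which \<open>has213_crossing\<close> does not cover. Avoidance is
  restrictive enough to leave a single word.\<close>

lemma crossing_1: "crossing 1 n = (if n = 3 then {[1, 3, 2]} else {})"
proof (intro equalityI subsetI)
  fix xs assume "xs \<in> crossing 1 n"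
  then obtain L l r R where xs: "xs \<in> permutations_of_set {1..n}" "good 1 1 xs" and
    LR: "xs = L @ l # n # R" "l < r" "r \<in> set R" "\<forall>x\<in>set L. r < x" "\<forall>y\<in>set R. y \<noteq> r \<longrightarrow> y < l"
    unfolding mem_crossing_iff by blast
  have d: "distinct (L @ l # n # R)" "set (L @ l # n # R) = {1..n}"
    using xs(1) LR(1) by (auto simp: permutations_of_set_def)
  have no: "\<not> (subseq [a, b, c] xs \<and> b < a \<and> a < c)" for a b c
    using xs(2) has213I[of a b "[c]" xs 1] by (auto simp: good_def)
  \<comment> \<open>A letter \<open>x\<close> of \<open>L\<close> would give the occurrence
    \<open>x l n\<close> of 2-1-3.\<close>
  have "L = []"
  proof (rule ccontr)
    assume "L \<noteq> []"
    then obtain x where x: "x \<in> set L"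
      using hd_in_set by blast
    then have "x < n"
      using d by (metis Un_iff atLeastAtMost_iff disjoint_iff distinct_append le_neq_implies_less
          list.set_intros set_append)
    moreover have "l < x"
      using LR(2,4) x by force
    moreover have "subseq [x, l, n] xs"
      unfolding LR(1) subseq3_append_iff using x by simp
    ultimately show False
      using no by blast
  qed
  have "R = [r]"
  proof -
    obtain y R' where R: "R = y # R'"
      using LR(3) by (cases R) auto
    \<comment> \<open>Any other first letter \<open>y\<close> of \<open>R\<close> would give the
      occurrence \<open>l y r\<close> of 2-1-3.\<close>
    have "y = r"
    proof (rule ccontr)
      assume "y \<noteq> r"
      then have "y < l" "r \<in> set R'"
        using LR(3,5) R by auto
      moreover from this have "subseq [l, y, r] xs"
        unfolding LR(1) \<open>L = []\<close> R by (simp add: subseq_singleton_left)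
      ultimately show False
        using no LR(2) by blast
    qed
    moreover have "R' = []"
    proof (rule ccontr)
      assume "R' \<noteq> []"
      then obtain z R'' where R': "R' = z # R''"
        by (cases R') auto
      \<comment> \<open>The prefix has even length, so \<open>R\<close> begins with an ascent
        \<open>r < z\<close>; but all letters of \<open>R\<close> other than \<open>r\<close> are
        below \<open>l\<close>.\<close>
      have "alternating_up ([l, n] @ R)"
        using xs(2) LR(1) \<open>L = []\<close> by (simp add: good_def)
      then have "alternating_up R"
        by (simp add: alternating_up_append del: append.simps)
      then have "r < z"
        unfolding alternating_up_def by (elim allE[of _ 0]) (simp add: R R' \<open>y = r\<close>)
      moreover have "z \<noteq> r"
        using d(1) R R' \<open>y = r\<close> by auto
      ultimately show False
        using LR(2,5) R R' by auto
    qed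
    ultimately show ?thesis
      using R by simp
  qed
  have "card (set [l, n, r]) = n"
    using d(2) \<open>L = []\<close> \<open>R = [r]\<close> by simp
  moreover have "distinct [l, n, r]"
    using d(1) \<open>L = []\<close> \<open>R = [r]\<close> by simp
  ultimately have "n = 3"
    by (simp add: distinct_card)
  moreover have "l \<in> {1..3}" "r \<in> {1..3}" "l \<noteq> 3" "r \<noteq> 3"
    using d \<open>L = []\<close> \<open>R = [r]\<close> \<open>n = 3\<close> by auto
  ultimately have "l = 1" "r = 2"
    using LR(2) by auto
  then show "xs \<in> (if n = 3 then {[1, 3, 2]} else {})"
    using LR(1) \<open>L = []\<close> \<open>R = [r]\<close> \<open>n = 3\<close> by simp
next
  fix xs :: "nat list" assume "xs \<in> (if n = 3 then {[1, 3, 2]} else {})"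
  then have n: "n = 3" and xs: "xs = [] @ 1 # 3 # [2]"
    by (auto split: if_splits)
  have "xs \<in> permutations_of_set {1..n}"
    unfolding xs n by (auto intro!: permutations_of_setI)
  moreover have occ: "occ132 [] = {}" "occ132 [2] = {}"
    by (auto simp: occ132_def)
  moreover have "occ132 xs = {(1, 3, 2)}"
    unfolding xs by (rule occ132_crossing) (use occ in auto)
  moreover have "alternating_up xs"
    by (simp add: xs alternating_up_def less_Suc_eq)
  moreover have "\<not> has213 1 xs"
  proof
    assume "has213 1 xs"
    then obtain a b w where *: "subseq (a # b # w) xs" "b < a" "sorted_wrt (<) (a # w)" "length w = 1"
      by (rule has213E)
    then obtain c where "w = [c]"
      by (auto simp: length_Suc_conv)
    then have "[a, b, c] = [1, 3, 2]"
      using subseq_same_length[OF *(1)] xs by simp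
    then show False
      using *(2) by simp
  qed
  ultimately have "good 1 1 xs" "xs \<in> permutations_of_set {1..n}"
    by (simp_all add: good_def)
  moreover have "xs = [] @ 1 # n # [2]" "(1::nat) < 2" "2 \<in> set [2::nat]" "\<forall>x\<in>set []. (2::nat) < x"
      "\<forall>y\<in>set [2::nat]. y \<noteq> 2 \<longrightarrow> y < 1"
    using n xs by simp_all
  ultimately show "xs \<in> crossing 1 n"
    unfolding mem_crossing_iff using occ by blast
qed

section \<open>Initial values and the link to \<open>ud\<close> and \<open>uu\<close>\<close>

lemma has213_short: "length xs \<le> 1 \<Longrightarrow> \<not> has213 j xs"
  by (auto simp: has213_def)

lemma num_good_length_0:
  "num_perms (good c j) 0 = (if c = 0 then 1 else 0)"
proof -
  have "{xs \<in> permutations_of_set {1..0}. good c j xs} = (if c = 0 then {[]} else {})"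
    by (auto simp: good_def has213_short occ132_short alternating_up_Nil)
  then show ?thesis
    by (simp add: num_perms_def)
qed

lemma num_good_length_1:
  "num_perms (good c j) 1 = (if c = 0 then 1 else 0)"
proof -
  have "{xs \<in> permutations_of_set {1..1}. good c j xs} = (if c = 0 then {[1]} else {})"
    by (auto simp: good_def has213_short occ132_short alternating_up_single)
  then show ?thesis
    unfolding num_perms_def by simp
qed

text \<open>The pattern is now 2-1. An alternating word with three or more letters has a descent at
  its second letter; of even lengths, \<open>[1, 2]\<close> would still survive.\<close>

lemma num_good_no_descent:
  assumes "odd n"
  shows "num_perms (good 0 0) n = (if n = 1 then 1 else 0)"
proof (cases "n = 1")
  case True
  then show ?thesis
    using num_good_length_1[of 0 0] by simp
next
  case False
  have "\<not> good 0 0 xs" if "xs \<in> permutations_of_set {1..n}" for xs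
  proof
    assume good: "good 0 0 xs"
    have "length xs = n"
      using that length_finite_permutations_of_set by fastforce
    moreover have "n \<ge> 3"
      using assms False by (cases n; cases "n - 1"; cases "n - 2") auto
    ultimately obtain a b c ys where xs: "xs = a # b # c # ys"
      by (auto simp: Suc_le_length_iff numeral_3_eq_3)
    have "alternating_up xs"
      using good by (simp add: good_def)
    then have "c < b"
      unfolding alternating_up_def by (elim allE[of _ 1]) (simp add: xs)
    moreover have "subseq [b, c] xs"
      by (simp add: xs)
    ultimately have "has213 0 xs"
      by (intro has213I[of b c "[]"]) auto
    then show False
      using good by (simp add: good_def)
  qed
  then have "{xs \<in> permutations_of_set {1..n}. good 0 0 xs} = {}"
    by blast
  then show ?thesis
    using False by (simp add: num_perms_def)
qed

text \<open>The last two letters of an occurrence of 1-3-2 form the pattern 2-1.\<close>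

lemma num_good_1_no_descent: "num_perms (good 1 0) n = 0"
proof -
  have "\<not> good 1 0 xs" for xs
  proof
    assume good: "good 1 0 xs"
    then have "occ132 xs \<noteq> {}"
      by (auto simp: good_def)
    then obtain a b c where "subseq [a, b, c] xs" "c < b"
      by (auto simp: occ132_def)
    then have "has213 0 xs"
      by (intro has213I[of b c "[]"]) (auto dest: subseq_Cons')
    then show False
      using good by (simp add: good_def)
  qed
  then show ?thesis
    by (simp add: num_perms_def)
qed

lemma patterns_eq_good:
  "{\<pi> \<in> permutations_of_set {1..n}. (length \<pi> \<ge> 2 \<and> P (length \<pi>) \<and> alternating_up \<pi>) \<and>
      contains_exactly_once \<pi> pattern_132 \<and> avoids \<pi> (pattern_213k (Suc (Suc j)))} =
   {xs \<in> permutations_of_set {1..n}. P (length xs) \<and> good 1 j xs}"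
proof -
  have "(length \<pi> \<ge> 2 \<and> P (length \<pi>) \<and> alternating_up \<pi>) \<and>
      contains_exactly_once \<pi> pattern_132 \<and> avoids \<pi> (pattern_213k (Suc (Suc j))) \<longleftrightarrow>
      P (length \<pi>) \<and> good 1 j \<pi>" if "\<pi> \<in> permutations_of_set {1..n}" for \<pi>
  proof -
    have d: "distinct \<pi>"
      using that by (rule permutations_of_setD)
    \<comment> \<open>The occurrence of 1-3-2 supplies the length bound that \<open>good\<close>
      does not mention.\<close>
    have "length \<pi> \<ge> 2" if "good 1 j \<pi>"
      using that occ132_short[of \<pi>] by (fastforce simp: good_def)
    then show ?thesis
      unfolding contains_exactly_once_132_iff[OF d] avoids_213k_iff[OF d] good_def by blast
  qed
  then show ?thesis
    by blast
qed

lemma ud_eq: "ud (Suc (Suc j)) n = (if odd n then num_perms (good 1 j) n else 0)"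
  unfolding ud_def up_down_def patterns_eq_good[of n odd]
  using num_perms_length_conj[of odd "good 1 j" n] by (simp only: num_perms_def)

lemma uu_eq: "uu (Suc (Suc j)) n = (if even n then num_perms (good 1 j) n else 0)"
  unfolding uu_def up_up_def patterns_eq_good[of n even]
  using num_perms_length_conj[of even "good 1 j" n] by (simp only: num_perms_def)

section \<open>Generating functions\<close>

unbundle fps_syntax

section \<open>Odd and even parts of power series\<close>

definition fps_parity :: "bool \<Rightarrow> rat fps \<Rightarrow> rat fps" where
  "fps_parity b f = Abs_fps (\<lambda>n. if odd n = b then f $ n else 0)"

lemma fps_parity_nth: "fps_parity b f $ n = (if odd n = b then f $ n else 0)"
  by (simp add: fps_parity_def)

lemma fps_parity_add: "fps_parity b (f + g) = fps_parity b f + fps_parity b g"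
  and fps_parity_diff: "fps_parity b (f - g) = fps_parity b f - fps_parity b g"
  by (auto simp: fps_eq_iff fps_parity_nth)

lemma fps_parity_1: "fps_parity b 1 = (if b then 0 else 1)"
  by (auto simp: fps_eq_iff fps_parity_nth)

lemma fps_parity_X: "fps_parity b fps_X = (if b then fps_X else 0)"
  by (auto simp: fps_eq_iff fps_parity_nth fps_X_def)

lemma fps_parity_X_power3: "fps_parity b (fps_X ^ 3) = (if b then fps_X ^ 3 else 0)"
  by (auto simp: fps_eq_iff fps_parity_nth fps_X_power_iff)

text \<open>An even factor keeps the parity of exponents. In the recurrences the factor is
  \<open>fps_X\<close> times an odd part or \<open>fps_X ^ 2\<close> times an even part, so each
  recurrence splits into one for odd and one for even lengths.\<close>

lemma fps_parity_mult_even: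
  assumes "\<And>n. odd n \<Longrightarrow> e $ n = 0"
  shows "fps_parity b (e * f) = e * fps_parity b f"
proof (rule fps_ext)
  fix n
  have "e $ i * fps_parity b f $ (n - i) = (if odd n = b then e $ i * f $ (n - i) else 0)"
    if "i \<le> n" for i
    using assms[of i] that by (cases "odd i") (auto simp: fps_parity_nth)
  then show "fps_parity b (e * f) $ n = (e * fps_parity b f) $ n"
    by (simp add: fps_parity_nth fps_mult_nth)
qed

lemma fps_parity_mult_X_odd:
  "fps_parity b (fps_X * fps_parity True e * f) = fps_X * fps_parity True e * fps_parity b f"
proof (rule fps_parity_mult_even)
  show "(fps_X * fps_parity True e) $ n = 0" if "odd n" for n
    using that by (cases n) (auto simp: fps_parity_nth)
qed

lemma fps_parity_mult_X2_even:
  "fps_parity b (fps_X ^ 2 * fps_parity False e * f) = fps_X ^ 2 * fps_parity False e * fps_parity b f"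
proof (rule fps_parity_mult_even)
  show "(fps_X ^ 2 * fps_parity False e) $ n = 0" if "odd n" for n
    using that by (auto simp: fps_X_power_mult_nth fps_parity_nth)
qed

lemma fps_X_mult_mult_nth:
  fixes f g :: "rat fps"
  shows "(fps_X * f * g) $ n = (\<Sum>i<n. f $ i * g $ (n - 1 - i))"
proof (cases n)
  case (Suc m)
  then have "(fps_X * (f * g)) $ n = (f * g) $ m"
    by simp
  also have "\<dots> = (\<Sum>i<n. f $ i * g $ (n - 1 - i))"
    by (simp add: Suc fps_mult_nth atLeast0AtMost lessThan_Suc_atMost)
  finally show ?thesis
    by (simp add: mult.assoc)
qed (simp add: mult.assoc)

section \<open>Functional equations for good words\<close>

definition good_fps :: "nat \<Rightarrow> nat \<Rightarrow> rat fps" where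
  "good_fps c j = Abs_fps (\<lambda>n. of_nat (num_perms (good c j) n))"

lemma good_fps_nth: "good_fps c j $ n = of_nat (num_perms (good c j) n)"
  by (simp add: good_fps_def)

lemma parity_good_fps_nth:
  "fps_parity b (good_fps c j) $ n = of_nat (if odd n = b then num_perms (good c j) n else 0)"
  by (simp add: good_fps_nth fps_parity_nth)

lemma num_good_small: "n < 2 \<Longrightarrow> num_perms (good c j) n = (if c = 0 then 1 else 0)"
  using num_good_length_0[of c j] num_good_length_1[of c j] by (auto simp: less_2_cases_iff)

text \<open>The summand \<open>1 + fps_X\<close> accounts for lengths 0 and 1, and the factor
  \<open>fps_X\<close> for the maximum.\<close>

lemma good_fps_0_rec:
  "good_fps 0 (Suc j) =
     1 + fps_X + fps_X * fps_parity True (good_fps 0 j) * good_fps 0 (Suc j)"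
proof (rule fps_ext)
  fix n
  show "good_fps 0 (Suc j) $ n =
    (1 + fps_X + fps_X * fps_parity True (good_fps 0 j) * good_fps 0 (Suc j)) $ n"
  proof (cases "n < 2")
    case True
    then show ?thesis
      by (auto simp: less_2_cases_iff fps_X_mult_mult_nth good_fps_nth num_good_small fps_parity_nth)
  next
    case False
    then have "n \<ge> 2"
      by simp
    then have "(of_nat (num_perms (good 0 (Suc j)) n) :: rat) =
       (\<Sum>i<n. of_nat (if odd i then num_perms (good 0 j) i else 0) *
          of_nat (num_perms (good 0 (Suc j)) (n - 1 - i)))"
      unfolding num_good_0_rec[OF \<open>n \<ge> 2\<close>] by simp
    moreover have "(1 + fps_X :: rat fps) $ n = 0"
      using False by (simp add: fps_X_def)
    ultimately show ?thesis
      by (simp add: fps_X_mult_mult_nth good_fps_nth parity_good_fps_nth)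
  qed
qed

lemma good_fps_1_rec:
  "good_fps 1 (Suc j) =
     fps_X * fps_parity True (good_fps 1 j) * good_fps 0 (Suc j) +
     fps_X * fps_parity True (good_fps 0 j) * good_fps 1 (Suc j) +
     Abs_fps (\<lambda>n. of_nat (card (crossing (Suc j) n)))"
proof (rule fps_ext)
  fix n
  show "good_fps 1 (Suc j) $ n = (fps_X * fps_parity True (good_fps 1 j) * good_fps 0 (Suc j) +
     fps_X * fps_parity True (good_fps 0 j) * good_fps 1 (Suc j) +
     Abs_fps (\<lambda>n. of_nat (card (crossing (Suc j) n)))) $ n"
  proof (cases "n < 2")
    case True
    have "crossing (Suc j) n \<subseteq> {xs \<in> permutations_of_set {1..n}. good 1 (Suc j) xs}"
      by (auto simp: crossing_def)
    moreover have "{xs \<in> permutations_of_set {1..n}. good 1 (Suc j) xs} = {}"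
      using num_good_small[OF True, of 1 "Suc j"] by (simp add: num_perms_def)
    ultimately have "crossing (Suc j) n = {}"
      by blast
    with True show ?thesis
      by (auto simp: less_2_cases_iff fps_X_mult_mult_nth good_fps_nth num_good_small fps_parity_nth)
  next
    case False
    then have n: "n \<ge> 2"
      by simp
    show ?thesis
      unfolding good_fps_nth num_good_1_rec[OF n]
      by (simp add: fps_X_mult_mult_nth good_fps_nth parity_good_fps_nth del: One_nat_def)
  qed
qed

lemma crossing_1_fps: "Abs_fps (\<lambda>n. of_nat (card (crossing (Suc 0) n)) :: rat) = fps_X ^ 3"
  using crossing_1 by (auto simp: fps_eq_iff fps_X_power_iff)

text \<open>The factor \<open>fps_X ^ 2\<close> stands for the letters \<open>l\<close> and
  \<open>n\<close>. Subtracting 1 removes the empty \<open>R\<close>, which does not contain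
  \<open>r\<close>.\<close>

lemma crossing_fps:
  "Abs_fps (\<lambda>n. of_nat (card (crossing (Suc (Suc j)) n))) =
     fps_X ^ 2 * fps_parity False (good_fps 0 (Suc j)) * (good_fps 0 (Suc (Suc j)) - 1)"
proof (rule fps_ext)
  fix n
  let ?f = "fps_parity False (good_fps 0 (Suc j))" and ?g = "good_fps 0 (Suc (Suc j)) - 1"
  show "Abs_fps (\<lambda>n. of_nat (card (crossing (Suc (Suc j)) n))) $ n = (fps_X ^ 2 * ?f * ?g) $ n"
  proof (cases "n < 2")
    case True
    then show ?thesis
      by (simp add: card_crossing mult.assoc fps_X_power_mult_nth)
  next
    case False
    define m where "m = n - 2"
    have g0: "?g $ 0 = 0"
      by (simp add: good_fps_nth num_good_length_0)
    have g: "?g $ i = of_nat (num_perms (good 0 (Suc (Suc j))) i)" if "i > 0" for i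
      using that by (simp add: good_fps_nth)
    have "(fps_X ^ 2 * ?f * ?g) $ n = (?f * ?g) $ m"
      using False by (simp add: mult.assoc fps_X_power_mult_nth m_def)
    also have "\<dots> = (\<Sum>i\<le>m. ?f $ i * ?g $ (m - i))"
      by (simp add: fps_mult_nth atLeast0AtMost)
    \<comment> \<open>The summand for \<open>i = m\<close> vanishes because \<open>?g\<close> has
      constant term 0.\<close>
    also have "\<dots> = (\<Sum>i<m. ?f $ i * ?g $ (m - i))"
      using g0 by (simp add: lessThan_Suc_atMost[symmetric])
    also have "\<dots> = (\<Sum>i<m. of_nat ((if even i then num_perms (good 0 (Suc j)) i else 0) *
        num_perms (good 0 (Suc (Suc j))) (m - i)))"
      by (intro sum.cong refl) (simp add: g parity_good_fps_nth del: fps_sub_nth)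
    finally show ?thesis
      by (simp add: card_crossing m_def)
  qed
qed

lemma odd_good_fps_0_0: "fps_parity True (good_fps 0 0) = fps_X"
  by (auto simp: fps_eq_iff parity_good_fps_nth num_good_no_descent fps_X_def)

lemma odd_good_fps_1_0: "fps_parity True (good_fps 1 0) = 0"
  using num_good_1_no_descent by (auto simp: fps_eq_iff parity_good_fps_nth)

section \<open>Odd and even parts as Laurent series\<close>

text \<open>With \<open>k = j + 2\<close>, \<open>odd0 j\<close>, \<open>odd1 j\<close> and
  \<open>even1 j\<close> are \<open>A_k\<close>, \<open>C_k\<close> and \<open>D_k\<close>. They are
  taken as Laurent series because \<open>Uhat\<close> has negative powers.\<close>

definition odd0 :: "nat \<Rightarrow> rat fls" where "odd0 j = fps_to_fls (fps_parity True (good_fps 0 j))"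
definition even0 :: "nat \<Rightarrow> rat fls" where "even0 j = fps_to_fls (fps_parity False (good_fps 0 j))"
definition odd1 :: "nat \<Rightarrow> rat fls" where "odd1 j = fps_to_fls (fps_parity True (good_fps 1 j))"
definition even1 :: "nat \<Rightarrow> rat fls" where "even1 j = fps_to_fls (fps_parity False (good_fps 1 j))"

lemmas fps_parity_simps = fps_parity_add fps_parity_diff fps_parity_1 fps_parity_X
  fps_parity_X_power3 fps_parity_mult_X_odd fps_parity_mult_X2_even

lemma odd0_0: "odd0 0 = fls_X"
  by (simp add: odd0_def odd_good_fps_0_0)

lemma parity_good_fps_0_rec:
  "fps_parity b (good_fps 0 (Suc j)) = (if b then fps_X else 1) +
     fps_X * fps_parity True (good_fps 0 j) * fps_parity b (good_fps 0 (Suc j))"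
  by (subst good_fps_0_rec) (simp add: fps_parity_simps)

lemma odd0_Suc: "odd0 (Suc j) = fls_X + fls_X * odd0 j * odd0 (Suc j)"
  unfolding odd0_def by (subst parity_good_fps_0_rec) (simp add: fls_times_fps_to_fls fps_to_fls_power)

lemma even0_Suc: "even0 (Suc j) = 1 + fls_X * odd0 j * even0 (Suc j)"
  unfolding odd0_def even0_def by (subst parity_good_fps_0_rec) (simp add: fls_times_fps_to_fls fps_to_fls_power)

lemma parity_good_fps_1_1:
  "fps_parity b (good_fps 1 (Suc 0)) =
     fps_X * fps_X * fps_parity b (good_fps 1 (Suc 0)) + (if b then fps_X ^ 3 else 0)"
proof -
  have "fps_parity b (good_fps 1 (Suc 0)) = fps_parity b (fps_X * fps_parity True (good_fps 0 0) *
      good_fps 1 (Suc 0)) + fps_parity b (fps_X ^ 3)"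
    by (subst good_fps_1_rec) (simp add: fps_parity_simps odd_good_fps_1_0[unfolded One_nat_def] crossing_1_fps)
  then show ?thesis
    unfolding fps_parity_mult_X_odd fps_parity_X_power3 unfolding odd_good_fps_0_0 .
qed

text \<open>The 1 subtracted for the empty \<open>R\<close> is an even series, so it appears only
  for \<open>b = False\<close>.\<close>

lemma parity_good_fps_1_rec:
  "fps_parity b (good_fps 1 (Suc (Suc j))) =
     fps_X * fps_parity True (good_fps 1 (Suc j)) * fps_parity b (good_fps 0 (Suc (Suc j))) +
     fps_X * fps_parity True (good_fps 0 (Suc j)) * fps_parity b (good_fps 1 (Suc (Suc j))) +
     fps_X ^ 2 * fps_parity False (good_fps 0 (Suc j)) *
       (fps_parity b (good_fps 0 (Suc (Suc j))) - (if b then 0 else 1))"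
  by (subst good_fps_1_rec) (simp add: fps_parity_simps crossing_fps)

lemma odd1_1: "odd1 (Suc 0) = fls_X * fls_X * odd1 (Suc 0) + fls_X ^ 3"
  unfolding odd1_def by (subst parity_good_fps_1_1) (simp add: fls_times_fps_to_fls fps_to_fls_power)

lemma even1_1: "even1 (Suc 0) = fls_X * fls_X * even1 (Suc 0)"
  unfolding even1_def by (subst parity_good_fps_1_1) (simp add: fls_times_fps_to_fls fps_to_fls_power)

lemma odd1_rec:
  "odd1 (Suc (Suc j)) = fls_X * odd1 (Suc j) * odd0 (Suc (Suc j)) +
     fls_X * odd0 (Suc j) * odd1 (Suc (Suc j)) +
     fls_X ^ 2 * even0 (Suc j) * odd0 (Suc (Suc j))"
  unfolding odd1_def odd0_def even0_def
  by (subst parity_good_fps_1_rec) (simp add: fls_times_fps_to_fls fps_to_fls_power)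

lemma even1_rec:
  "even1 (Suc (Suc j)) = fls_X * odd1 (Suc j) * even0 (Suc (Suc j)) +
     fls_X * odd0 (Suc j) * even1 (Suc (Suc j)) +
     fls_X ^ 2 * even0 (Suc j) * (even0 (Suc (Suc j)) - 1)"
  unfolding odd1_def odd0_def even0_def even1_def
  by (subst parity_good_fps_1_rec) (simp add: fls_times_fps_to_fls fps_to_fls_power)

section \<open>Chebyshev polynomials\<close>

lemma Uhat_minus_1: "Uhat (-1) = 0"
  and Uhat_0: "Uhat 0 = 1"
  by (simp_all add: Uhat_def cheb_U_minus_1 cheb_U_0)

text \<open>The Chebyshev recurrence at \<open>t = 1 / (2x)\<close>, where
  \<open>2t = 1 / x\<close>, multiplied by \<open>x\<close>.\<close>

lemma Uhat_rec:
  assumes "r \<ge> 0"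
  shows "Uhat r = fls_X * (Uhat (r + 1) + Uhat (r - 1))"
proof -
  define y :: "rat fls" where "y = 1 / (2 * fls_X)"
  have "(2 * fls_X :: rat fls) \<noteq> 0"
    by simp
  then have "2 * fls_X * y = 1"
    unfolding y_def by (metis divide_self mult_1_right times_divide_eq_right)
  moreover have "Uhat (r + 1) = 2 * y * Uhat r - Uhat (r - 1)"
  proof -
    have "cheb_U (r + 1) = [:0, 2:] * cheb_U r - (cheb_U (r - 1) :: rat fls poly)"
      using cheb_U_rec[of "r + 1"] assms by simp
    then show ?thesis
      unfolding Uhat_def y_def[symmetric] by (simp add: mult_ac)
  qed
  ultimately show ?thesis
    by algebra
qed

text \<open>The recurrence makes the left-hand side independent of \<open>j\<close>; at
  \<open>j = 0\<close> it is 1.\<close>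

lemma Uhat_cassini: "Uhat (int j) ^ 2 - Uhat (int j - 1) * Uhat (int j + 1) = 1"
proof (induction j)
  case 0
  then show ?case
    by (simp add: Uhat_minus_1 Uhat_0)
next
  case (Suc j)
  have r1: "Uhat (int j) = fls_X * (Uhat (int j + 1) + Uhat (int j - 1))"
    by (rule Uhat_rec) simp
  have r2: "Uhat (int j + 1) = fls_X * (Uhat (int j + 2) + Uhat (int j))"
    using Uhat_rec[of "int j + 1"] by (simp add: add.assoc)
  have "Uhat (int j + 1) * Uhat (int j + 1) - Uhat (int j) * Uhat (int j + 2) =
      Uhat (int j) * Uhat (int j) - Uhat (int j - 1) * Uhat (int j + 1)"
  proof -
    define x a b c d where "x = (fls_X :: rat fls)" and "a = Uhat (int j - 1)" and "b = Uhat (int j)"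
      and "c = Uhat (int j + 1)" and "d = Uhat (int j + 2)"
    have "b = x * (c + a)" "c = x * (d + b)"
      using r1 r2 by (simp_all add: x_def a_def b_def c_def d_def)
    \<comment> \<open>Both sides equal \<open>b * c\<close>: insert the first recurrence on the left
      and the second on the right.\<close>
    then have "x * (c * c + a * c) = x * (b * b + b * d)"
      by algebra
    moreover have "x \<noteq> 0"
      by (simp add: x_def)
    ultimately have "c * c + a * c = b * b + b * d"
      by (metis mult_left_cancel)
    then have "c * c - b * d = b * b - a * c"
      by algebra
    then show ?thesis
      by (simp add: a_def b_def c_def d_def)
  qed
  then show ?case
    using Suc.IH by (simp add: power2_eq_square add_ac)
qed

section \<open>The generating functions in terms of Chebyshev polynomials\<close>

text \<open>Both claims are proved together: the product formula passes nonvanishing from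
  \<open>Uhat (int j)\<close> to the next index.\<close>

lemma odd0_Uhat: "odd0 j * Uhat (int j + 1) = Uhat (int j)" "Uhat (int j) \<noteq> 0"
proof (induction j)
  case 0
  {
    case 1
    then show ?case
      using Uhat_rec[of 0] by (simp add: odd0_0 Uhat_minus_1 Uhat_0)
  next
    case 2
    then show ?case
      by (simp add: Uhat_0)
  }
next
  case (Suc j)
  {
    case 1
    have "Uhat (int j + 1) = fls_X * (Uhat (int j + 2) + odd0 j * Uhat (int j + 1))"
      using Uhat_rec[of "int j + 1"] Suc.IH(1) by (simp add: add.assoc)
    \<comment> \<open>Multiply \<open>odd0 (Suc j) * (1 - fls_X * odd0 j) = fls_X\<close> by
      \<open>Uhat (int j + 1)\<close>; by the line above,
      \<open>(1 - fls_X * odd0 j) * Uhat (int j + 1)\<close> is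
      \<open>fls_X * Uhat (int j + 2)\<close>.\<close>
    then have "fls_X * (odd0 (Suc j) * Uhat (int j + 2)) = fls_X * Uhat (int j + 1)"
      using odd0_Suc[of j] by algebra
    then show ?case
      by (simp add: add_ac)
  next
    case 2
    show ?case
      using Suc.IH by (auto simp: add_ac)
  }
qed

text \<open>Both series solve linear equations with coefficient \<open>1 - fls_X * odd0 j\<close>,
  with right-hand sides 1 and \<open>fls_X\<close>.\<close>

lemma X_even0: "fls_X * even0 (Suc j) = odd0 (Suc j)"
proof -
  have "even0 (Suc j) * (1 - fls_X * odd0 j) = 1"
    using even0_Suc[of j] by algebra
  then show ?thesis
    using odd0_Suc[of j] by algebra
qed

text \<open>Solve \<open>odd1_rec\<close> by multiplying with \<open>even0 (Suc (Suc j))\<close>,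
  the inverse of \<open>1 - fls_X * odd0 (Suc j)\<close>; \<open>X_even0\<close> then turns each
  even series into an odd one.\<close>

lemma odd1_eq_odd0_square:
  "odd1 (Suc (Suc j)) = odd0 (Suc (Suc j)) ^ 2 * (odd1 (Suc j) + odd0 (Suc j))"
proof -
  have "even0 (Suc (Suc j)) * (1 - fls_X * odd0 (Suc j)) = 1"
    using even0_Suc[of "Suc j"] by algebra
  then show ?thesis
    using odd1_rec[of j] X_even0[of j] X_even0[of "Suc j"] by algebra
qed

text \<open>The starting value, computed directly because the crossing term for 2-1-3 is the
  exceptional \<open>fls_X ^ 3\<close>.\<close>

lemma odd1_Suc_0: "odd1 (Suc 0) = fls_X ^ 2 * odd0 (Suc 0)"
proof -
  have "even0 (Suc 0) * (1 - fls_X * fls_X) = 1"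
    using even0_Suc[of 0] unfolding odd0_0 by algebra
  then show ?thesis
    using odd1_1 X_even0[of 0] by algebra
qed

text \<open>Multiplied by \<open>fls_X\<close>, \<open>even1_rec\<close> becomes
  \<open>odd1_rec\<close> except for the term with \<open>- 1\<close>; solving for the difference
  gives the product of the two \<open>odd0\<close>.\<close>

lemma X_even1: "fls_X * even1 (Suc j) = odd1 (Suc j) - fls_X * odd0 j * odd0 (Suc j)"
proof (cases j)
  case 0
  have "even0 (Suc 0) * (1 - fls_X * fls_X) = 1"
    using even0_Suc[of 0] unfolding odd0_0 by algebra
  then have "even1 (Suc 0) = 0"
    using even1_1 by algebra
  then show ?thesis
    by (simp add: 0 odd1_Suc_0 odd0_0 power2_eq_square)
next
  case (Suc i)
  have "even0 (Suc (Suc i)) * (1 - fls_X * odd0 (Suc i)) = 1"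
    using even0_Suc[of "Suc i"] by algebra
  then show ?thesis
    unfolding Suc odd1_eq_odd0_square using even1_rec[of i] X_even0[of i] X_even0[of "Suc i"] by algebra
qed

text \<open>The bounds are integers, so that for \<open>m = 0\<close> the remaining sum ends at -1
  and is empty.\<close>

lemma sum_int_Suc:
  fixes f :: "int \<Rightarrow> 'a :: comm_monoid_add"
  assumes "m \<ge> 0"
  shows "(\<Sum>i = 0..m. f i) = (\<Sum>i = 0..m - 1. f i) + f m"
proof -
  have "{0..m} = insert m {0..m - 1}"
    using assms by auto
  then show ?thesis
    by (simp add: add.commute)
qed

text \<open>Multiplying \<open>odd1_eq_odd0_square\<close> by the squared \<open>Uhat\<close>
  absorbs the squared \<open>odd0\<close> and shifts the index, so each step only adds one product
  of neighbouring values.\<close>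

lemma odd1_Uhat:
  "odd1 (Suc j) * Uhat (int j + 2) ^ 2 = (\<Sum>i = 0..int j. Uhat (i + 1) * Uhat i) - fls_X"
proof (induction j)
  case 0
  have "odd0 (Suc 0) * Uhat 2 = Uhat 1"
    using odd0_Uhat(1)[of 1] by simp
  moreover have "1 = fls_X * Uhat 1"
    using Uhat_rec[of 0] by (simp add: Uhat_0 Uhat_minus_1)
  moreover have "Uhat 1 = fls_X * (Uhat 2 + 1)"
    using Uhat_rec[of 1] by (simp add: Uhat_0)
  \<comment> \<open>The left side is \<open>fls_X ^ 2 * Uhat 1 * Uhat 2\<close>, which is
    \<open>fls_X * Uhat 2\<close> by \<open>fls_X * Uhat 1 = 1\<close>, and so
    \<open>Uhat 1 - fls_X\<close>.\<close>
  ultimately have "odd1 (Suc 0) * Uhat 2 ^ 2 = Uhat 1 - fls_X"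
    unfolding odd1_Suc_0 by algebra
  then show ?case
    by (simp add: Uhat_0)
next
  case (Suc j)
  have "odd0 (Suc (Suc j)) * Uhat (int j + 3) = Uhat (int j + 2)"
    using odd0_Uhat(1)[of "Suc (Suc j)"] by (simp add: add_ac)
  moreover have "odd0 (Suc j) * Uhat (int j + 2) = Uhat (int j + 1)"
    using odd0_Uhat(1)[of "Suc j"] by (simp add: add_ac)
  moreover have "odd1 (Suc (Suc j)) * Uhat (int j + 3) ^ 2 =
      (odd0 (Suc (Suc j)) * Uhat (int j + 3)) ^ 2 * (odd1 (Suc j) + odd0 (Suc j))"
    unfolding odd1_eq_odd0_square by (simp only: power_mult_distrib mult_ac)
  ultimately have "odd1 (Suc (Suc j)) * Uhat (int j + 3) ^ 2 =
      odd1 (Suc j) * Uhat (int j + 2) ^ 2 + Uhat (int j + 2) * Uhat (int j + 1)"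
    by (simp add: power2_eq_square algebra_simps)
  also have "\<dots> = (\<Sum>i = 0..int j. Uhat (i + 1) * Uhat i) + Uhat (int j + 2) * Uhat (int j + 1) - fls_X"
    using Suc.IH by simp
  also have "\<dots> = (\<Sum>i = 0..int (Suc j). Uhat (i + 1) * Uhat i) - fls_X"
    using sum_int_Suc[of "int (Suc j)" "\<lambda>i. Uhat (i + 1) * Uhat i"] by (simp add: add_ac)
  finally show ?case
    by (simp add: add_ac)
qed

text \<open>By \<open>X_even1\<close>, the formula for \<open>odd1\<close> loses
  \<open>fls_X * Uhat (int j) * Uhat (int j + 2)\<close>. Expanding its last summand
  \<open>Uhat (int j) * Uhat (int j + 1)\<close> by the recurrence leaves
  \<open>fls_X * (Uhat (int j) ^ 2 - 1)\<close>, to which the Cassini identity applies.\<close>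

lemma even1_Uhat:
  "fls_X * even1 (Suc j) * Uhat (int j + 2) ^ 2 =
     fls_X * Uhat (int j - 1) * Uhat (int j + 1) + (\<Sum>i = 0..int j - 1. Uhat i * Uhat (i + 1))"
proof -
  have a: "odd0 (Suc j) * Uhat (int j + 2) = Uhat (int j + 1)" "odd0 j * Uhat (int j + 1) = Uhat (int j)"
    using odd0_Uhat(1)[of "Suc j"] odd0_Uhat(1)[of j] by (simp_all add: add_ac)
  have r: "Uhat (int j + 1) = fls_X * (Uhat (int j + 2) + Uhat (int j))"
    using Uhat_rec[of "int j + 1"] by (simp add: add.assoc)
  have "(\<Sum>i = 0..int j. Uhat (i + 1) * Uhat i) =
      (\<Sum>i = 0..int j - 1. Uhat i * Uhat (i + 1)) + Uhat (int j) * Uhat (int j + 1)"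
    using sum_int_Suc[of "int j" "\<lambda>i. Uhat (i + 1) * Uhat i"] by (simp add: mult.commute)
  then show ?thesis
    unfolding X_even1 using odd1_Uhat[of j] a r Uhat_cassini[of j] by algebra
qed

theorem theorem4p7:
  fixes k :: nat
  assumes "k \<ge> 3"
  shows "fps_to_fls (Abs_fps (\<lambda>n. of_nat (ud k n) :: rat)) =
           1 / (Uhat (int k - 1))\<^sup>2 * ((\<Sum>j = 0..int k - 3. Uhat (j + 1) * Uhat j) - fls_X) \<and>
         fps_to_fls (Abs_fps (\<lambda>n. of_nat (uu k n) :: rat)) =
           1 / (fls_X * (Uhat (int k - 1))\<^sup>2) *
             (fls_X * Uhat (int k - 4) * Uhat (int k - 2) + (\<Sum>j = 0..int k - 4. Uhat j * Uhat (j + 1)))"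
proof -
  \<comment> \<open>Since \<open>good\<close> uses the index \<open>k - 2\<close>, the relevant
    series are those with index \<open>Suc j\<close>.\<close>
  obtain j where k: "k = Suc (Suc (Suc j))"
    using assms by (auto simp: numeral_3_eq_3 Suc_le_eq dest!: less_imp_Suc_add)
  have idx: "int k - 1 = int j + 2" "int k - 2 = int j + 1" "int k - 3 = int j" "int k - 4 = int j - 1"
    by (simp_all add: k)
  have nz: "Uhat (int j + 2) \<noteq> 0"
    using odd0_Uhat(2)[of "Suc (Suc j)"] by (simp add: add_ac)
  have "fps_to_fls (Abs_fps (\<lambda>n. of_nat (ud k n) :: rat)) = odd1 (Suc j)"
    by (simp add: odd1_def fps_parity_def good_fps_def k ud_eq if_distrib cong: if_cong)
  moreover have "fps_to_fls (Abs_fps (\<lambda>n. of_nat (uu k n) :: rat)) = even1 (Suc j)"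
    by (simp add: even1_def fps_parity_def good_fps_def k uu_eq if_distrib cong: if_cong)
  ultimately show ?thesis
    unfolding idx using nz odd1_Uhat[of j] even1_Uhat[of j]
    by (simp add: field_simps)
qed

end
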